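(* For each positive $\varrho_0=(\varrho_{0,0},\varrho_{1,0})\in L^\infty(\mathbb{R}^d\to\mathbb{R}^2)$, the system of kinetic equations $$\frac{d}{dt}\varrho_{0,t}=(a_0*\varrho_{0,t})\exp\left(-(\phi_0*\varrho_{1,t})\right)-\varrho_{0,t}\left(a_0*\exp\left(-(\phi_0*\varrho_{1,t})\right)\right),$$ $$\frac{d}{dt}\varrho_{1,t}=(a_1*\varrho_{1,t})\exp\left(-(\phi_1*\varrho_{0,t})\right)-\varrho_{1,t}\left(a_1*\exp\left(-(\phi_1*\varrho_{0,t})\right)\right),$$ with the initial condition $(\varrho_{0,t},\varrho_{1,t})|_{t=0}=(\varrho_{0,0},\varrho_{1,0})$, has a unique positive global solution such that, for all $t\ge0$ and Lebesgue-almost all $x\in\mathbb{R}^d$, $$\varrho_{i,t}(x)\le\|\varrho_{i,0}\|_{L^\infty}\exp(\alpha_it),\qquad i=0,1.$$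
   Context: For $i=0,1$: $a_i:\mathbb{R}^d\to[0,+\infty)$ with $a_i(x)=a_i(-x)$ and $\int_{\mathbb{R}^d}a_i(x)dx=:\alpha_i<\infty$; $\phi_i:\mathbb{R}^d\to[0,+\infty)$ with $\phi_i(x)=\phi_i(-x)$, $\int_{\mathbb{R}^d}\phi_i(x)dx=:\langle\phi_i\rangle<\infty$ and $\mathrm{ess\,sup}_x\phi_i(x)<\infty$. $*$ denotes convolution on $\mathbb{R}^d$. $\|\cdot\|_{L^\infty}$ is the norm of $L^\infty(\mathbb{R}^d\to\mathbb{R})$, and $L^\infty(\mathbb{R}^d\to\mathbb{R}^2)$ is equipped with $\|\varrho\|_\infty=\max_{i=0,1}\|\varrho_i\|_{L^\infty}$. An element $\varrho=(\varrho_0,\varrho_1)$ of it is positive if $\varrho_i(x)\ge0$, $i=0,1$, for almost all $x$. A global solution of the system, subject to an initial condition, is a continuously differentiable map $[0,+\infty)\ni t\mapsto(\varrho_{0,t},\varrho_{1,t})\in L^\infty(\mathbb{R}^d\to\mathbb{R}^2)$ such that both equations hold (and the initial condition is satisfied). It is called positive if $\varrho_{i,t}(x)\ge0$, $i=0,1$, for all $t\ge0$ and Lebesgue-almost all $x$. *)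

theory Defs
  imports "HOL-Analysis.Analysis" "HOL-Probability.Essential_Supremum"
begin

text \<open>
  The library has no \<open>L\<^sup>\<infinity>\<close> space. The type \<open>'a linf\<close> is \<open>L\<^sup>\<infinity>('a \<rightarrow> \<real>)\<close> for Lebesgue measure:
  classes, modulo equality almost everywhere, of Lebesgue measurable and essentially bounded
  functions. The norm is the essential supremum of the absolute value.
\<close>

definition linf_norm :: "('a::euclidean_space \<Rightarrow> real) \<Rightarrow> real" where
  "linf_norm f = real_of_ereal (esssup lebesgue (\<lambda>x. ereal \<bar>f x\<bar>))"

definition linf_fun :: "('a::euclidean_space \<Rightarrow> real) \<Rightarrow> bool" where
  "linf_fun f \<longleftrightarrow> f \<in> borel_measurable lebesgue \<and> esssup lebesgue (\<lambda>x. ereal \<bar>f x\<bar>) < \<infinity>"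

definition linf_rel :: "('a::euclidean_space \<Rightarrow> real) \<Rightarrow> ('a \<Rightarrow> real) \<Rightarrow> bool" where
  "linf_rel f g \<longleftrightarrow> linf_fun f \<and> linf_fun g \<and> (AE x in lebesgue. f x = g x)"

lemma linf_fun_AE_iff:
  "linf_fun f \<longleftrightarrow> f \<in> borel_measurable lebesgue \<and> (\<exists>C. AE x in lebesgue. \<bar>f x\<bar> \<le> C)"
proof (cases "f \<in> borel_measurable lebesgue")
  case m: True
  show ?thesis
  proof
    assume "linf_fun f"
    then have fin: "esssup lebesgue (\<lambda>x. ereal \<bar>f x\<bar>) < \<infinity>"
      by (simp add: linf_fun_def)
    then obtain C where "esssup lebesgue (\<lambda>x. ereal \<bar>f x\<bar>) \<le> ereal C"
      by (cases "esssup lebesgue (\<lambda>x. ereal \<bar>f x\<bar>)") auto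
    with esssup_AE[of "\<lambda>x. ereal \<bar>f x\<bar>" lebesgue] have "AE x in lebesgue. \<bar>f x\<bar> \<le> C"
      by (auto elim!: eventually_mono dest: order_trans)
    with m show "f \<in> borel_measurable lebesgue \<and> (\<exists>C. AE x in lebesgue. \<bar>f x\<bar> \<le> C)"
      by blast
  next
    assume "f \<in> borel_measurable lebesgue \<and> (\<exists>C. AE x in lebesgue. \<bar>f x\<bar> \<le> C)"
    then obtain C where "AE x in lebesgue. \<bar>f x\<bar> \<le> C" by blast
    then have "esssup lebesgue (\<lambda>x. ereal \<bar>f x\<bar>) \<le> ereal C"
      using m by (intro esssup_I) auto
    with m show "linf_fun f"
      unfolding linf_fun_def by (auto intro: le_less_trans)
  qed
qed (simp add: linf_fun_def)

lemma AE_le_linf_norm: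
  assumes "linf_fun f"
  shows "AE x in lebesgue. \<bar>f x\<bar> \<le> linf_norm f"
  using esssup_AE[of "\<lambda>x. ereal \<bar>f x\<bar>" lebesgue]
proof eventually_elim
  case (elim x)
  then show ?case
    using assms by (cases "esssup lebesgue (\<lambda>x. ereal \<bar>f x\<bar>)") (auto simp: linf_norm_def linf_fun_def)
qed

lemma AE_lebesgue_const: "(AE x::'a::euclidean_space in lebesgue. P) \<longleftrightarrow> P"
proof -
  have "ae_filter (lebesgue :: 'a measure) \<noteq> bot"
    by (simp add: ae_filter_eq_bot_iff)
  then show ?thesis
    using eventually_const by blast
qed

lemma linf_norm_nonneg:
  fixes f :: "'a::euclidean_space \<Rightarrow> real"
  assumes "linf_fun f"
  shows "0 \<le> linf_norm f"
proof -
  from AE_le_linf_norm[OF assms] have "AE x::'a in lebesgue. 0 \<le> linf_norm f"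
    by eventually_elim linarith
  then show ?thesis
    by (simp add: AE_lebesgue_const)
qed

lemma linf_norm_leI:
  fixes f :: "'a::euclidean_space \<Rightarrow> real"
  assumes "linf_fun f" "AE x in lebesgue. \<bar>f x\<bar> \<le> C"
  shows "linf_norm f \<le> C"
proof -
  have "esssup lebesgue (\<lambda>x. ereal \<bar>f x\<bar>) \<le> ereal C"
    using assms by (intro esssup_I) (auto simp: linf_fun_def)
  moreover have "AE x::'a in lebesgue. 0 \<le> C"
    using assms(2) by eventually_elim linarith
  then have "0 \<le> C"
    by (simp add: AE_lebesgue_const)
  ultimately show ?thesis
    unfolding linf_norm_def
    by (cases "esssup lebesgue (\<lambda>x. ereal \<bar>f x\<bar>)") auto
qed

lemma linf_norm_cong:
  assumes "linf_rel f g"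
  shows "linf_norm f = linf_norm g"
proof -
  have "esssup lebesgue (\<lambda>x. ereal \<bar>f x\<bar>) = esssup lebesgue (\<lambda>x. ereal \<bar>g x\<bar>)"
    using assms by (intro esssup_AE_cong) (auto simp: linf_rel_def linf_fun_def elim: eventually_mono)
  then show ?thesis
    by (simp add: linf_norm_def)
qed

lemma linf_fun_zero: "linf_fun (\<lambda>x. 0)"
  by (auto simp: linf_fun_AE_iff)

lemma linf_fun_add:
  assumes "linf_fun f" "linf_fun g"
  shows "linf_fun (\<lambda>x. f x + g x)"
proof -
  obtain C D where "AE x in lebesgue. \<bar>f x\<bar> \<le> C" "AE x in lebesgue. \<bar>g x\<bar> \<le> D"
    using assms by (auto simp: linf_fun_AE_iff)
  then have "AE x in lebesgue. \<bar>f x + g x\<bar> \<le> C + D"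
    by eventually_elim linarith
  with assms show ?thesis
    by (auto simp: linf_fun_AE_iff)
qed

lemma linf_fun_scale:
  assumes "linf_fun f"
  shows "linf_fun (\<lambda>x. c * f x)"
proof -
  obtain C where "AE x in lebesgue. \<bar>f x\<bar> \<le> C"
    using assms by (auto simp: linf_fun_AE_iff)
  then have "AE x in lebesgue. \<bar>c * f x\<bar> \<le> \<bar>c\<bar> * C"
    by eventually_elim (simp add: abs_mult mult_left_mono)
  with assms show ?thesis
    by (auto simp: linf_fun_AE_iff)
qed

lemma linf_fun_diff:
  assumes "linf_fun f" "linf_fun g"
  shows "linf_fun (\<lambda>x. f x - g x)"
  using linf_fun_add[OF assms(1) linf_fun_scale[OF assms(2), of "-1"]] by simp

lemma part_equivp_linf_rel:
  "part_equivp (linf_rel :: ('a::euclidean_space \<Rightarrow> real) \<Rightarrow> _)"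
proof (rule part_equivpI)
  show "\<exists>f :: 'a \<Rightarrow> real. linf_rel f f"
    using linf_fun_zero by (auto simp: linf_rel_def)
  show "symp (linf_rel :: ('a \<Rightarrow> real) \<Rightarrow> _)"
    by (auto simp: linf_rel_def symp_def elim: eventually_mono)
  show "transp (linf_rel :: ('a \<Rightarrow> real) \<Rightarrow> _)"
  proof (rule transpI)
    fix f g h :: "'a \<Rightarrow> real"
    assume fg: "linf_rel f g" and gh: "linf_rel g h"
    then have "AE x in lebesgue. f x = g x" "AE x in lebesgue. g x = h x"
      by (auto simp: linf_rel_def)
    then have "AE x in lebesgue. f x = h x"
      by eventually_elim simp
    with fg gh show "linf_rel f h"
      by (simp add: linf_rel_def)
  qed
qed

text \<open>
  The morphism \<open>rep_linf\<close> chooses some representative of a class, so every use of it below is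
  either in a statement about almost every point or under an integral sign.
\<close>

quotient_type (overloaded) 'a linf = "'a::euclidean_space \<Rightarrow> real" / partial: linf_rel
  by (rule part_equivp_linf_rel)

lemma linf_fun_rep_linf: "linf_fun (rep_linf f)"
  using Quotient3_rep_reflp[OF Quotient3_linf, of f] by (simp add: linf_rel_def)

lemma rep_abs_linf:
  assumes "linf_fun f"
  shows "AE x in lebesgue. rep_linf (abs_linf f) x = f x"
proof -
  have "linf_rel f f"
    using assms by (simp add: linf_rel_def)
  then show ?thesis
    using rep_abs_rsp_left[OF Quotient3_linf, of f f] by (simp add: linf_rel_def)
qed

lemma linf_eq_iff: "f = g \<longleftrightarrow> (AE x in lebesgue. rep_linf f x = rep_linf g x)"
  using Quotient3_rel_rep[OF Quotient3_linf, of f g] linf_fun_rep_linf[of f] linf_fun_rep_linf[of g]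
  by (auto simp: linf_rel_def)

instantiation linf :: (euclidean_space) real_vector
begin

lift_definition zero_linf :: "'a linf" is "\<lambda>x. 0"
  by (simp add: linf_rel_def linf_fun_zero)

lift_definition plus_linf :: "'a linf \<Rightarrow> 'a linf \<Rightarrow> 'a linf" is "\<lambda>f g x. f x + g x"
  unfolding linf_rel_def
  by (auto intro: linf_fun_add elim: eventually_elim2)

lift_definition scaleR_linf :: "real \<Rightarrow> 'a linf \<Rightarrow> 'a linf" is "\<lambda>c f x. c * f x"
  unfolding linf_rel_def
  by (auto intro: linf_fun_scale elim: eventually_mono)

lift_definition uminus_linf :: "'a linf \<Rightarrow> 'a linf" is "\<lambda>f x. - f x"
  unfolding linf_rel_def
  by (auto dest: linf_fun_scale[of _ "-1"] elim: eventually_mono)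

lift_definition minus_linf :: "'a linf \<Rightarrow> 'a linf \<Rightarrow> 'a linf" is "\<lambda>f g x. f x - g x"
  unfolding linf_rel_def
  by (auto intro: linf_fun_diff elim: eventually_elim2)

instance
proof
  fix f g h :: "'a linf" and r s :: real
  show "f + g + h = f + (g + h)"
    by transfer (auto simp: linf_rel_def add.assoc intro!: linf_fun_add)
  show "f + g = g + f"
    by transfer (auto simp: linf_rel_def add.commute intro!: linf_fun_add)
  show "0 + f = f"
    by transfer (auto simp: linf_rel_def)
  show "- f + f = 0"
    by transfer (auto simp: linf_rel_def linf_fun_zero)
  show "f - g = f + - g"
    by transfer (auto simp: linf_rel_def intro: linf_fun_diff)
  show "r *\<^sub>R (f + g) = r *\<^sub>R f + r *\<^sub>R g"
    by transfer
      (auto simp: linf_rel_def distrib_left[symmetric] intro!: linf_fun_add linf_fun_scale)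
  show "(r + s) *\<^sub>R f = r *\<^sub>R f + s *\<^sub>R f"
    by transfer
      (auto simp: linf_rel_def distrib_right[symmetric] intro!: linf_fun_add linf_fun_scale)
  show "r *\<^sub>R s *\<^sub>R f = (r * s) *\<^sub>R f"
    by transfer
      (auto simp: linf_rel_def mult.assoc[symmetric] intro!: linf_fun_scale)
  show "1 *\<^sub>R f = f"
    by transfer (auto simp: linf_rel_def)
qed

end

instantiation linf :: (euclidean_space) real_normed_vector
begin

lift_definition norm_linf :: "'a linf \<Rightarrow> real" is linf_norm
  by (rule linf_norm_cong)

definition dist_linf :: "'a linf \<Rightarrow> 'a linf \<Rightarrow> real" where
  "dist_linf f g = norm (f - g)"

definition sgn_linf :: "'a linf \<Rightarrow> 'a linf" where
  "sgn_linf f = f /\<^sub>R norm f"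

definition uniformity_linf :: "('a linf \<times> 'a linf) filter" where
  "uniformity_linf = (INF e\<in>{0<..}. principal {(f, g). dist f g < e})"

definition open_linf :: "'a linf set \<Rightarrow> bool" where
  "open_linf U \<longleftrightarrow> (\<forall>f\<in>U. \<forall>\<^sub>F (f', g) in uniformity. f' = f \<longrightarrow> g \<in> U)"

instance
proof
  fix f g :: "'a linf" and r :: real
  show "norm f = 0 \<longleftrightarrow> f = 0"
  proof transfer
    fix f :: "'a \<Rightarrow> real"
    assume "linf_rel f f"
    then have f: "linf_fun f"
      by (simp add: linf_rel_def)
    show "linf_norm f = 0 \<longleftrightarrow> linf_rel f (\<lambda>x. 0)"
    proof
      assume "linf_norm f = 0"
      with AE_le_linf_norm[OF f] f show "linf_rel f (\<lambda>x. 0)"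
        by (auto simp: linf_rel_def linf_fun_zero elim: eventually_mono)
    next
      assume "linf_rel f (\<lambda>x. 0)"
      then have "linf_norm f \<le> 0"
        by (intro linf_norm_leI) (auto simp: linf_rel_def elim: eventually_mono)
      with linf_norm_nonneg[OF f] show "linf_norm f = 0"
        by linarith
    qed
  qed
  show "norm (f + g) \<le> norm f + norm g"
  proof transfer
    fix f g :: "'a \<Rightarrow> real"
    assume "linf_rel f f" "linf_rel g g"
    then have fg: "linf_fun f" "linf_fun g"
      by (simp_all add: linf_rel_def)
    show "linf_norm (\<lambda>x. f x + g x) \<le> linf_norm f + linf_norm g"
    proof (rule linf_norm_leI)
      show "linf_fun (\<lambda>x. f x + g x)"
        using fg by (rule linf_fun_add)
      show "AE x in lebesgue. \<bar>f x + g x\<bar> \<le> linf_norm f + linf_norm g"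
        using AE_le_linf_norm[OF fg(1)] AE_le_linf_norm[OF fg(2)]
        by eventually_elim linarith
    qed
  qed
  show "norm (r *\<^sub>R f) = \<bar>r\<bar> * norm f"
  proof transfer
    fix r :: real and f :: "'a \<Rightarrow> real"
    assume "linf_rel f f"
    then have f: "linf_fun f"
      by (simp add: linf_rel_def)
    have le: "linf_norm (\<lambda>x. c * f x) \<le> \<bar>c\<bar> * linf_norm f" if "linf_fun f"
      for c and f :: "'a \<Rightarrow> real"
      using linf_fun_scale[OF that] AE_le_linf_norm[OF that]
      by (intro linf_norm_leI) (auto simp: abs_mult mult_left_mono elim!: eventually_mono)
    show "linf_norm (\<lambda>x. r * f x) = \<bar>r\<bar> * linf_norm f"
    proof (cases "r = 0")
      case True
      then show ?thesis
        using le[OF f, of 0] linf_norm_nonneg[OF linf_fun_zero, where 'a = 'a] by auto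
    next
      case False
      have "linf_norm f \<le> \<bar>inverse r\<bar> * linf_norm (\<lambda>x. r * f x)"
        using le[OF linf_fun_scale[OF f], of "inverse r" r] False
        by (simp add: mult.assoc[symmetric])
      then have "\<bar>r\<bar> * linf_norm f \<le> linf_norm (\<lambda>x. r * f x)"
        using False by (simp add: field_simps)
      with le[OF f, of r] show ?thesis
        by linarith
    qed
  qed
qed (auto simp: dist_linf_def sgn_linf_def uniformity_linf_def open_linf_def)

end

text \<open>
  \<open>'a linf2\<close> is \<open>L\<^sup>\<infinity>('a \<rightarrow> \<real>\<^sup>2)\<close> with the maximum of the norms of the two components. It is a
  separate type because the library equips pairs with the Euclidean combination of the norms.
\<close>

context
  notes [[typedef_overloaded]]
begin

datatype 'a linf2 = Linf2 (comp0: "'a::euclidean_space linf") (comp1: "'a linf")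

end

instantiation linf2 :: (euclidean_space) real_vector
begin

definition zero_linf2 :: "'a linf2" where
  "zero_linf2 = Linf2 0 0"

definition plus_linf2 :: "'a linf2 \<Rightarrow> 'a linf2 \<Rightarrow> 'a linf2" where
  "plus_linf2 u v = Linf2 (comp0 u + comp0 v) (comp1 u + comp1 v)"

definition minus_linf2 :: "'a linf2 \<Rightarrow> 'a linf2 \<Rightarrow> 'a linf2" where
  "minus_linf2 u v = Linf2 (comp0 u - comp0 v) (comp1 u - comp1 v)"

definition uminus_linf2 :: "'a linf2 \<Rightarrow> 'a linf2" where
  "uminus_linf2 u = Linf2 (- comp0 u) (- comp1 u)"

definition scaleR_linf2 :: "real \<Rightarrow> 'a linf2 \<Rightarrow> 'a linf2" where
  "scaleR_linf2 c u = Linf2 (c *\<^sub>R comp0 u) (c *\<^sub>R comp1 u)"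

instance
  by standard (auto simp: zero_linf2_def plus_linf2_def minus_linf2_def uminus_linf2_def
    scaleR_linf2_def algebra_simps)

end

instantiation linf2 :: (euclidean_space) real_normed_vector
begin

definition norm_linf2 :: "'a linf2 \<Rightarrow> real" where
  "norm_linf2 u = max (norm (comp0 u)) (norm (comp1 u))"

definition dist_linf2 :: "'a linf2 \<Rightarrow> 'a linf2 \<Rightarrow> real" where
  "dist_linf2 u v = norm (u - v)"

definition sgn_linf2 :: "'a linf2 \<Rightarrow> 'a linf2" where
  "sgn_linf2 u = u /\<^sub>R norm u"

definition uniformity_linf2 :: "('a linf2 \<times> 'a linf2) filter" where
  "uniformity_linf2 = (INF e\<in>{0<..}. principal {(u, v). dist u v < e})"

definition open_linf2 :: "'a linf2 set \<Rightarrow> bool" where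
  "open_linf2 U \<longleftrightarrow> (\<forall>u\<in>U. \<forall>\<^sub>F (u', v) in uniformity. u' = u \<longrightarrow> v \<in> U)"

instance
proof
  fix u v :: "'a linf2" and r :: real
  show "norm u = 0 \<longleftrightarrow> u = 0"
    by (cases u) (auto simp: norm_linf2_def zero_linf2_def max_def
        intro: antisym[OF _ norm_ge_zero])
  show "norm (u + v) \<le> norm u + norm v"
    using norm_triangle_ineq[of "comp0 u" "comp0 v"] norm_triangle_ineq[of "comp1 u" "comp1 v"]
    by (auto simp: norm_linf2_def plus_linf2_def)
  show "norm (r *\<^sub>R u) = \<bar>r\<bar> * norm u"
    by (simp add: norm_linf2_def scaleR_linf2_def max_mult_distrib_left)
qed (auto simp: dist_linf2_def sgn_linf2_def uniformity_linf2_def open_linf2_def)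

end

definition positive_linf2 :: "'a::euclidean_space linf2 \<Rightarrow> bool" where
  "positive_linf2 u \<longleftrightarrow>
     (AE x in lebesgue. 0 \<le> rep_linf (comp0 u) x \<and> 0 \<le> rep_linf (comp1 u) x)"

definition convolution ::
    "('a::euclidean_space \<Rightarrow> real) \<Rightarrow> ('a \<Rightarrow> real) \<Rightarrow> 'a \<Rightarrow> real" where
  "convolution f g x = (\<integral>y. f (x - y) * g y \<partial>lebesgue)"

definition kinetic_rhs ::
    "('a::euclidean_space \<Rightarrow> real) \<Rightarrow> ('a \<Rightarrow> real) \<Rightarrow> ('a \<Rightarrow> real) \<Rightarrow> ('a \<Rightarrow> real) \<Rightarrow> 'a \<Rightarrow> real" where
  "kinetic_rhs a \<phi> f g x =
     convolution a f x * exp (- convolution \<phi> g x)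
     - f x * convolution a (\<lambda>y. exp (- convolution \<phi> g y)) x"

text \<open>
  The time derivative is the Frechet derivative in \<open>'a linf2\<close> (one-sided at \<open>t = 0\<close>), so the
  equations are equalities in \<open>L\<^sup>\<infinity>\<close>, written out below for almost every point. Values of \<open>u\<close> at
  negative times are irrelevant.
\<close>

definition global_solution ::
    "('a::euclidean_space \<Rightarrow> real) \<Rightarrow> ('a \<Rightarrow> real) \<Rightarrow> ('a \<Rightarrow> real) \<Rightarrow> ('a \<Rightarrow> real) \<Rightarrow>
     'a linf2 \<Rightarrow> (real \<Rightarrow> 'a linf2) \<Rightarrow> bool" where
  "global_solution a\<^sub>0 a\<^sub>1 \<phi>\<^sub>0 \<phi>\<^sub>1 r u \<longleftrightarrow>
     u 0 = r \<and>
     (\<exists>D. continuous_on {0..} D \<and>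
       (\<forall>t\<ge>0. (u has_vector_derivative D t) (at t within {0..}) \<and>
         (AE x in lebesgue. rep_linf (comp0 (D t)) x =
            kinetic_rhs a\<^sub>0 \<phi>\<^sub>0 (rep_linf (comp0 (u t))) (rep_linf (comp1 (u t))) x) \<and>
         (AE x in lebesgue. rep_linf (comp1 (D t)) x =
            kinetic_rhs a\<^sub>1 \<phi>\<^sub>1 (rep_linf (comp1 (u t))) (rep_linf (comp0 (u t))) x)))"

definition positive_global_solution ::
    "('a::euclidean_space \<Rightarrow> real) \<Rightarrow> ('a \<Rightarrow> real) \<Rightarrow> ('a \<Rightarrow> real) \<Rightarrow> ('a \<Rightarrow> real) \<Rightarrow>
     'a linf2 \<Rightarrow> (real \<Rightarrow> 'a linf2) \<Rightarrow> bool" where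
  "positive_global_solution a\<^sub>0 a\<^sub>1 \<phi>\<^sub>0 \<phi>\<^sub>1 r u \<longleftrightarrow>
     global_solution a\<^sub>0 a\<^sub>1 \<phi>\<^sub>0 \<phi>\<^sub>1 r u \<and> (\<forall>t\<ge>0. positive_linf2 (u t))"

end

theory Submission
  imports Defs
begin

text \<open>
  The loss term of each equation is \<open>\<rho>\<^sub>i\<close> times a factor that lies between \<open>0\<close> and \<open>\<alpha>\<^sub>i\<close> as long as the
  solution is positive. Hence, with \<open>\<lambda> = \<alpha>\<^sub>0 + \<alpha>\<^sub>1\<close>, adding \<open>\<lambda> \<rho>\<close> to the right-hand side makes it
  nonnegative on the positive cone, and the substitution \<open>v t = exp (\<lambda> t) u t\<close> turns the system into
  \<open>v' = H t v\<close> with \<open>H\<close> nonnegative there. Since \<open>exp (- \<phi> * \<rho>)\<close> has values in \<open>[0, 1]\<close> for \<open>\<rho> \<ge> 0\<close>,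
  the inequalities \<open>0 \<le> v\<^sub>i \<le> m\<^sub>i\<close> imply \<open>0 \<le> (H t v)\<^sub>i \<le> (\<lambda> + \<alpha>\<^sub>i) m\<^sub>i\<close> (lemma \<open>kinetic_linf_bounds\<close>).
  The function \<open>m\<^sub>i t = \<parallel>\<rho>\<^sub>i\<parallel> exp ((\<lambda> + \<alpha>\<^sub>i) t)\<close> satisfies \<open>m\<^sub>i' = (\<lambda> + \<alpha>\<^sub>i) m\<^sub>i\<close>, so the Picard iteration
  never leaves the tube of all \<open>v\<close> with \<open>0 \<le> v\<^sub>i \<le> m\<^sub>i t\<close> at time \<open>t\<close>. This tube contains both the positivity
  and the growth bound: undoing the substitution turns \<open>m\<^sub>i t\<close> into \<open>\<parallel>\<rho>\<^sub>i\<parallel> exp (\<alpha>\<^sub>i t)\<close>.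

  Order must survive integration of functions with values in \<open>L\<^sup>\<infinity>\<close>. It does because an order
  interval is a ball: \<open>0 \<le> f \<le> m\<close> almost everywhere iff \<open>\<parallel>f - m/2\<parallel> \<le> m/2\<close> (lemma
  \<open>AE_interval_iff_norm\<close>), so order estimates follow from the norm estimate for derivatives.

  On bounded sets of positive functions the field is Lipschitz (lemma \<open>kinetic_linf_lipschitz\<close>),
  because \<open>s \<mapsto> exp (- s)\<close> is a contraction on \<open>s \<ge> 0\<close>. On every bounded time interval the tube is
  such a set, so the Picard iterates converge for all times (theorem \<open>picard_lindelof_tube\<close>). Any two
  positive solutions are continuous, hence bounded on \<open>[0, t]\<close>, and agree by Gronwall's argument.
\<close>

section \<open>Differential equations in Banach spaces\<close>

text \<open>
  The mean value inequality, phrased for one-sided derivatives at \<open>0\<close>. It replaces every estimate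
  of a vector-valued integral below.
\<close>

lemma norm_increment_le:
  fixes x :: "real \<Rightarrow> 'a::real_normed_vector"
  assumes t: "0 \<le> t"
    and x: "\<And>s. 0 \<le> s \<Longrightarrow> s \<le> t \<Longrightarrow> (x has_vector_derivative y s) (at s within {0..})"
    and p: "\<And>s. 0 \<le> s \<Longrightarrow> s \<le> t \<Longrightarrow> (p has_vector_derivative q s) (at s within {0..})"
    and le: "\<And>s. 0 \<le> s \<Longrightarrow> s \<le> t \<Longrightarrow> norm (y s) \<le> q s"
  shows "norm (x t - x 0) \<le> p t - p (0::real)"
proof (cases "t = 0")
  case False
  have cont: "continuous_on {0..t} f"
    if "\<And>s. 0 \<le> s \<Longrightarrow> s \<le> t \<Longrightarrow> (f has_vector_derivative g s) (at s within {0..})"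
    for f g :: "real \<Rightarrow> 'b::real_normed_vector"
    unfolding continuous_on_eq_continuous_within
    by (auto intro!: has_vector_derivative_continuous has_vector_derivative_within_subset[OF that])
  have at: "at s within {0..} = at s" if "0 < s" for s :: real
    using that by (intro at_within_interior) (auto simp: interior_real_atLeast)
  show ?thesis
  proof (rule differentiable_bound_general[where f' = y and \<phi>' = q])
    show "0 < t" using t False by simp
    show "continuous_on {0..t} x" "continuous_on {0..t} p"
      using cont x p by blast+
  qed (use x p le at in \<open>metis less_imp_le\<close>)+
qed simp

text \<open>
  The induction step shared by the Picard iteration and by Gronwall's argument: integrating \<open>L\<close> times
  the \<open>n\<close>-th term of the series of \<open>M exp (L t)\<close> gives the next term.
\<close>

lemma norm_increment_le_power_fact:
  fixes x :: "real \<Rightarrow> 'a::real_normed_vector"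
  assumes t: "0 \<le> t"
    and x: "\<And>s. 0 \<le> s \<Longrightarrow> s \<le> t \<Longrightarrow> (x has_vector_derivative y s) (at s within {0..})"
    and le: "\<And>s. 0 \<le> s \<Longrightarrow> s \<le> t \<Longrightarrow> norm (y s) \<le> L * (M * (L * s) ^ n / fact n)"
  shows "norm (x t - x 0) \<le> M * (L * t) ^ Suc n / fact (Suc n)"
proof -
  define p where "p s = M * (L * s) ^ Suc n / fact (Suc n)" for s
  have "(p has_vector_derivative L * (M * (L * s) ^ n / fact n)) (at s within {0..})" for s
  proof -
    have "(p has_real_derivative M * (real (Suc n) * (L * s) ^ n * L) / fact (Suc n)) (at s within {0..})"
      unfolding p_def by (rule derivative_eq_intros refl | simp)+
    also have "M * (real (Suc n) * (L * s) ^ n * L) / fact (Suc n) = L * (M * (L * s) ^ n / fact n)"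
      by (simp add: divide_simps del: of_nat_Suc)
    finally show ?thesis
      by (simp add: has_real_derivative_iff_has_vector_derivative)
  qed
  from norm_increment_le[OF t x this le] show ?thesis
    by (simp add: p_def)
qed

lemma tendsto_power_fact_0:
  fixes c :: real
  shows "(\<lambda>n. M * c ^ n / fact n) \<longlonglongrightarrow> 0"
  using tendsto_mult_right_zero[OF summable_LIMSEQ_zero[OF summable_exp[of c]], of M]
  by (simp add: field_simps)

text \<open>
  Starting from a bound \<open>M\<close> of \<open>w\<close> on \<open>[0, t]\<close> and integrating \<open>n\<close> times, \<open>w\<close> is bounded by the \<open>n\<close>-th
  term of the series of \<open>M exp (L t)\<close>, which tends to \<open>0\<close>.
\<close>

lemma gronwall_zero:
  fixes w :: "real \<Rightarrow> 'a::real_normed_vector"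
  assumes t: "0 \<le> t"
    and w: "\<And>s. 0 \<le> s \<Longrightarrow> s \<le> t \<Longrightarrow> (w has_vector_derivative w' s) (at s within {0..})"
    and le: "\<And>s. 0 \<le> s \<Longrightarrow> s \<le> t \<Longrightarrow> norm (w' s) \<le> L * norm (w s)"
    and L: "0 \<le> L"
    and 0: "w 0 = 0"
  shows "w t = 0"
proof -
  have "continuous_on {0..t} w"
    unfolding continuous_on_eq_continuous_within
    by (auto intro!: has_vector_derivative_continuous has_vector_derivative_within_subset[OF w])
  then have "bounded (w ` {0..t})"
    by (intro compact_imp_bounded compact_continuous_image) auto
  then obtain M where M: "\<And>s. 0 \<le> s \<Longrightarrow> s \<le> t \<Longrightarrow> norm (w s) \<le> M"
    unfolding bounded_iff by force
  have "norm (w s) \<le> M * (L * s) ^ n / fact n" if "0 \<le> s" "s \<le> t" for s n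
    using that
  proof (induction n arbitrary: s)
    case (Suc n)
    have "norm (w s - w 0) \<le> M * (L * s) ^ Suc n / fact (Suc n)"
    proof (rule norm_increment_le_power_fact)
      fix s' assume s': "0 \<le> s'" "s' \<le> s"
      then show "norm (w' s') \<le> L * (M * (L * s') ^ n / fact n)"
        using Suc.prems by (intro order_trans[OF le] mult_left_mono Suc.IH L) auto
    qed (use Suc.prems w in auto)
    then show ?case by (simp add: 0)
  qed (use M in simp)
  with t have "norm (w t) \<le> 0"
    by (intro LIMSEQ_le_const[OF tendsto_power_fact_0[of M "L * t"]]) auto
  then show ?thesis by simp
qed

lemma indefinite_integral_has_vector_derivative:
  fixes f :: "real \<Rightarrow> 'a::banach"
  assumes f: "continuous_on {0..} f" and t: "0 \<le> t"
  shows "((\<lambda>t. integral {0..t} f) has_vector_derivative f t) (at t within {0..})"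
proof -
  have "continuous_on {0..t + 1} f"
    using f by (rule continuous_on_subset) auto
  then have "((\<lambda>t. integral {0..t} f) has_vector_derivative f t) (at t within {0..t + 1})"
    using t by (intro integral_has_vector_derivative) auto
  moreover have "at t within {0..t + 1} = at t within {0..}"
    by (rule at_within_nhd[of t "{..<t + 1}"]) auto
  ultimately show ?thesis by simp
qed

text \<open>
  Picard iteration inside a moving closed set \<open>K t\<close>. The Lipschitz condition concerns only points
  of \<open>K t\<close> and bounded time intervals, so a field that is merely locally Lipschitz has a
  solution for all times once \<open>K\<close> is mapped into itself by the iteration (assumption \<open>inv\<close>). This
  invariance is stated with derivatives, without integrals: \<open>w\<close> is the next iterate after \<open>u\<close>.
\<close>

theorem picard_lindelof_tube:
  fixes H :: "real \<Rightarrow> 'a::banach \<Rightarrow> 'a" and K :: "real \<Rightarrow> 'a set"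
  assumes closed: "\<And>t. 0 \<le> t \<Longrightarrow> closed (K t)"
    and start: "\<And>t. 0 \<le> t \<Longrightarrow> r \<in> K t"
    and cont: "\<And>u. continuous_on {0..} u \<Longrightarrow> (\<And>t. 0 \<le> t \<Longrightarrow> u t \<in> K t) \<Longrightarrow>
        continuous_on {0..} (\<lambda>t. H t (u t))"
    and lip: "\<And>T. 0 \<le> T \<Longrightarrow> \<exists>L\<ge>0. \<forall>t\<in>{0..T}. \<forall>x\<in>K t. \<forall>y\<in>K t.
        norm (H t x - H t y) \<le> L * norm (x - y)"
    and inv: "\<And>u w. (\<And>t. 0 \<le> t \<Longrightarrow> u t \<in> K t) \<Longrightarrow> w 0 = r \<Longrightarrow>
        (\<And>t. 0 \<le> t \<Longrightarrow> (w has_vector_derivative H t (u t)) (at t within {0..})) \<Longrightarrow>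
        (\<And>t. 0 \<le> t \<Longrightarrow> w t \<in> K t)"
  obtains u where "u 0 = r" and "\<And>t. 0 \<le> t \<Longrightarrow> u t \<in> K t"
    and "\<And>t. 0 \<le> t \<Longrightarrow> (u has_vector_derivative H t (u t)) (at t within {0..})"
proof -
  define \<Phi> where "\<Phi> u t = r + integral {0..t} (\<lambda>s. H s (u s))" for u t
  define good where "good u \<longleftrightarrow> continuous_on {0..} u \<and> (\<forall>t\<ge>0. u t \<in> K t)" for u
  have \<Phi>0: "\<Phi> u 0 = r" for u
    by (simp add: \<Phi>_def)
  have \<Phi>': "(\<Phi> u has_vector_derivative H t (u t)) (at t within {0..})"
    if "good u" "0 \<le> t" for u t
    using indefinite_integral_has_vector_derivative[OF cont[of u] \<open>0 \<le> t\<close>] that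
    unfolding \<Phi>_def good_def by (auto intro!: derivative_eq_intros)
  have good_\<Phi>: "good (\<Phi> u)" if "good u" for u
    unfolding good_def
  proof (intro conjI allI impI)
    show "continuous_on {0..} (\<Phi> u)"
      unfolding continuous_on_eq_continuous_within
      by (auto intro: has_vector_derivative_continuous[OF \<Phi>'[OF that]])
    show "\<Phi> u t \<in> K t" if "0 \<le> t" for t
      by (rule inv[of u "\<Phi> u", OF _ \<Phi>0 \<Phi>'[OF \<open>good u\<close>] that])
        (use \<open>good u\<close> in \<open>simp_all add: good_def\<close>)
  qed
  define U where "U n = (\<Phi> ^^ n) (\<lambda>_. r)" for n
  have U_Suc: "U (Suc n) = \<Phi> (U n)" for n
    by (simp add: U_def)
  have good_U: "good (U n)" for n
  proof (induction n)
    case 0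
    show ?case using start by (simp add: U_def good_def)
  qed (simp add: U_Suc good_\<Phi>)
  have U0: "U n 0 = r" for n
    by (cases n) (simp_all add: U_Suc \<Phi>0 U_def)
  \<comment> \<open>The pointwise limit of the iterates, as a telescoping series, to which the Weierstrass test applies.\<close>
  define u where "u t = r + (\<Sum>n. U (Suc n) t - U n t)" for t
  have unif: "uniform_limit {0..T} U u sequentially" if "0 \<le> T" for T
  proof -
    obtain L where L: "0 \<le> L"
      and L_le: "\<And>t x y. 0 \<le> t \<Longrightarrow> t \<le> T \<Longrightarrow> x \<in> K t \<Longrightarrow> y \<in> K t \<Longrightarrow>
        norm (H t x - H t y) \<le> L * norm (x - y)"
      using lip[OF \<open>0 \<le> T\<close>] by auto
    have "continuous_on {0..T} (\<lambda>t. U 1 t - U 0 t)"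
      using good_U[of 0] good_U[of 1] unfolding good_def
      by (intro continuous_intros) (auto elim: continuous_on_subset)
    then have "bounded ((\<lambda>t. U 1 t - U 0 t) ` {0..T})"
      by (intro compact_imp_bounded compact_continuous_image) auto
    then obtain M where M: "\<And>s. 0 \<le> s \<Longrightarrow> s \<le> T \<Longrightarrow> norm (U 1 s - U 0 s) \<le> M"
      unfolding bounded_iff by force
    have "0 \<le> M" using M[of 0] \<open>0 \<le> T\<close> norm_ge_zero order_trans by blast
    have step: "norm (U (Suc n) t - U n t) \<le> M * (L * t) ^ n / fact n" if "0 \<le> t" "t \<le> T" for n t
      using that
    proof (induction n arbitrary: t)
      case (Suc n)
      let ?d = "\<lambda>t. U (Suc (Suc n)) t - U (Suc n) t"
      have "norm (?d t - ?d 0) \<le> M * (L * t) ^ Suc n / fact (Suc n)"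
      proof (rule norm_increment_le_power_fact)
        fix s assume s: "0 \<le> s" "s \<le> t"
        show "(?d has_vector_derivative (H s (U (Suc n) s) - H s (U n s))) (at s within {0..})"
          unfolding U_Suc[of "Suc n"] U_Suc[of n]
          using good_U[of n] good_U[of "Suc n"] s
          by (intro has_vector_derivative_diff \<Phi>') (auto simp: U_Suc)
        have "norm (H s (U (Suc n) s) - H s (U n s)) \<le> L * norm (U (Suc n) s - U n s)"
          using s Suc.prems good_U unfolding good_def by (intro L_le) auto
        also have "\<dots> \<le> L * (M * (L * s) ^ n / fact n)"
          using s Suc.prems by (intro mult_left_mono Suc.IH L) auto
        finally show "norm (H s (U (Suc n) s) - H s (U n s)) \<le> L * (M * (L * s) ^ n / fact n)" .
      qed (use Suc.prems in auto)
      then show ?case by (simp add: U0)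
    qed (use M in simp)
    have "uniform_limit {0..T} (\<lambda>n t. \<Sum>i<n. U (Suc i) t - U i t)
        (\<lambda>t. \<Sum>i. U (Suc i) t - U i t) sequentially"
    proof (rule Weierstrass_m_test)
      show "summable (\<lambda>n. M * (inverse (fact n) * (L * T) ^ n))"
        by (intro summable_mult summable_exp)
      show "norm (U (Suc n) t - U n t) \<le> M * (inverse (fact n) * (L * T) ^ n)" if "t \<in> {0..T}" for n t
      proof -
        have "M * (L * t) ^ n / fact n \<le> M * (L * T) ^ n / fact n"
          using that L \<open>0 \<le> M\<close>
          by (intro divide_right_mono mult_left_mono power_mono) (auto intro!: mult_left_mono)
        with step[of t n] that show ?thesis by (auto simp: field_simps)
      qed
    qed
    then have "uniform_limit {0..T} (\<lambda>n t. r + (\<Sum>i<n. U (Suc i) t - U i t)) u sequentially"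
      unfolding u_def by (intro uniform_limit_intros)
    moreover have "r + (\<Sum>i<n. U (Suc i) t - U i t) = U n t" for n t
      using sum_lessThan_telescope[of "\<lambda>i. U i t" n] by (simp add: U_def)
    ultimately show ?thesis by simp
  qed
  have lim: "(\<lambda>n. U n t) \<longlonglongrightarrow> u t" if "0 \<le> t" for t
    using tendsto_uniform_limitI[OF unif[OF that], of t] that by simp
  have "good u"
    unfolding good_def
  proof (intro conjI allI impI)
    show "continuous_on {0..} u"
      unfolding continuous_on_eq_continuous_within
    proof
      fix t :: real assume "t \<in> {0..}"
      have "continuous_on {0..t + 1} u"
        using good_U unfolding good_def
        using \<open>t \<in> {0..}\<close>
        by (intro uniform_limit_theorem[OF _ unif] always_eventually allI)
          (auto intro: continuous_on_subset[where s = "{0..}"])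
      then have "continuous (at t within {0..t + 1}) u"
        using \<open>t \<in> {0..}\<close> by (auto simp: continuous_on_eq_continuous_within)
      moreover have "at t within {0..t + 1} = at t within {0..}"
        by (rule at_within_nhd[of t "{..<t + 1}"]) auto
      ultimately show "continuous (at t within {0..}) u"
        by (simp add: continuous_within)
    qed
    show "u t \<in> K t" if "0 \<le> t" for t
      using closed_sequentially[OF closed[OF that] _ lim[OF that]] good_U that
      by (auto simp: good_def)
  qed
  have fix_u: "\<Phi> u t = u t" if t: "0 \<le> t" for t
  proof -
    obtain L where L: "0 \<le> L"
      and L_le: "\<And>s x y. 0 \<le> s \<Longrightarrow> s \<le> t \<Longrightarrow> x \<in> K s \<Longrightarrow> y \<in> K s \<Longrightarrow>
        norm (H s x - H s y) \<le> L * norm (x - y)"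
      using lip[OF \<open>0 \<le> t\<close>] by auto
    have "uniform_limit {0..t} (\<lambda>n s. H s (U n s)) (\<lambda>s. H s (u s)) sequentially"
    proof (rule uniform_limitI)
      fix e :: real assume "0 < e"
      \<comment> \<open>Dividing by \<open>L + 1\<close> also covers the case \<open>L = 0\<close>.\<close>
      then have "0 < e / (L + 1)" using L by simp
      from uniform_limitD[OF unif[OF t] this]
      show "\<forall>\<^sub>F n in sequentially. \<forall>s\<in>{0..t}. dist (H s (U n s)) (H s (u s)) < e"
      proof (rule eventually_mono, intro ballI)
        fix n s assume *: "\<forall>s\<in>{0..t}. dist (U n s) (u s) < e / (L + 1)" and s: "s \<in> {0..t}"
        have "norm (H s (U n s) - H s (u s)) \<le> L * norm (U n s - u s)"
          using s good_U \<open>good u\<close> unfolding good_def by (intro L_le) auto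
        also have "\<dots> \<le> (L + 1) * norm (U n s - u s)"
          by (intro mult_right_mono) auto
        also have "\<dots> < e"
          using * s L by (auto simp: dist_norm field_simps)
        finally show "dist (H s (U n s)) (H s (u s)) < e"
          by (simp add: dist_norm)
      qed
    qed
    then obtain I J where I: "\<And>n. ((\<lambda>s. H s (U n s)) has_integral I n) {0..t}"
      and J: "((\<lambda>s. H s (u s)) has_integral J) {0..t}" and IJ: "I \<longlonglongrightarrow> J"
    proof (rule uniform_limit_integral)
      show "continuous_on {0..t} (\<lambda>s. H s (U n s))" for n
        using good_U[of n] cont[of "U n"] unfolding good_def
        by (auto intro: continuous_on_subset)
    qed auto
    have "(\<lambda>n. U (Suc n) t) \<longlonglongrightarrow> \<Phi> u t"
      using tendsto_add[OF tendsto_const IJ, of r] I[THEN integral_unique] integral_unique[OF J]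
      by (simp add: U_Suc \<Phi>_def)
    moreover have "(\<lambda>n. U (Suc n) t) \<longlonglongrightarrow> u t"
      using lim[OF t] by (rule LIMSEQ_Suc)
    ultimately show ?thesis by (rule LIMSEQ_unique)
  qed
  show thesis
  proof (rule that)
    show "u 0 = r" using fix_u[of 0] by (simp add: \<Phi>0)
    show "u t \<in> K t" if "0 \<le> t" for t using \<open>good u\<close> that by (simp add: good_def)
    show "(u has_vector_derivative H t (u t)) (at t within {0..})" if "0 \<le> t" for t
      by (rule has_vector_derivative_transform[OF _ _ \<Phi>'[OF \<open>good u\<close> that]]) (use that fix_u in auto)
  qed
qed

section \<open>The Banach algebra of essentially bounded functions\<close>

lemma linf_fun_mult:
  assumes "linf_fun f" "linf_fun g"
  shows "linf_fun (\<lambda>x. f x * g x)"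
proof -
  have "AE x in lebesgue. \<bar>f x * g x\<bar> \<le> linf_norm f * linf_norm g"
    using AE_le_linf_norm[OF assms(1)] AE_le_linf_norm[OF assms(2)]
    by eventually_elim (simp add: abs_mult mult_mono')
  with assms show ?thesis
    by (auto simp: linf_fun_AE_iff)
qed

lemma linf_fun_one: "linf_fun (\<lambda>x. 1)"
  by (auto simp: linf_fun_AE_iff)

instantiation linf :: (euclidean_space) real_normed_algebra_1
begin

lift_definition one_linf :: "'a linf" is "\<lambda>x. 1"
  by (simp add: linf_rel_def linf_fun_one)

lift_definition times_linf :: "'a linf \<Rightarrow> 'a linf \<Rightarrow> 'a linf" is "\<lambda>f g x. f x * g x"
  unfolding linf_rel_def
  by (auto intro: linf_fun_mult elim: eventually_elim2)

instance
proof
  fix f g h :: "'a linf" and r :: real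
  show "f * g * h = f * (g * h)"
    by transfer (auto simp: linf_rel_def mult.assoc intro!: linf_fun_mult)
  show "(f + g) * h = f * h + g * h"
    by transfer (auto simp: linf_rel_def distrib_right intro!: linf_fun_mult linf_fun_add)
  show "f * (g + h) = f * g + f * h"
    by transfer (auto simp: linf_rel_def distrib_left intro!: linf_fun_mult linf_fun_add)
  show "1 * f = f" "f * 1 = f"
    by (transfer; simp add: linf_rel_def)+
  show "(0::'a linf) \<noteq> 1"
    by transfer (auto simp: linf_rel_def AE_lebesgue_const)
  show "r *\<^sub>R f * g = r *\<^sub>R (f * g)" "f * r *\<^sub>R g = r *\<^sub>R (f * g)"
    by (transfer; auto simp: linf_rel_def algebra_simps intro!: linf_fun_mult linf_fun_scale)+
  show "norm (f * g) \<le> norm f * norm g"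
  proof transfer
    fix f g :: "'a \<Rightarrow> real"
    assume "linf_rel f f" "linf_rel g g"
    then have fg: "linf_fun f" "linf_fun g"
      by (simp_all add: linf_rel_def)
    show "linf_norm (\<lambda>x. f x * g x) \<le> linf_norm f * linf_norm g"
    proof (rule linf_norm_leI)
      show "AE x in lebesgue. \<bar>f x * g x\<bar> \<le> linf_norm f * linf_norm g"
        using AE_le_linf_norm[OF fg(1)] AE_le_linf_norm[OF fg(2)]
        by eventually_elim (simp add: abs_mult mult_mono')
    qed (rule linf_fun_mult[OF fg])
  qed
  show "norm (1::'a linf) = 1"
  proof transfer
    have "AE x::'a in lebesgue. 1 \<le> linf_norm (\<lambda>_::'a. 1)"
      using AE_le_linf_norm[OF linf_fun_one, where 'a = 'a] by eventually_elim simp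
    moreover have "linf_norm (\<lambda>_::'a. 1) \<le> 1"
      by (intro linf_norm_leI linf_fun_one) simp
    ultimately show "linf_norm (\<lambda>_::'a. 1) = 1"
      by (simp add: AE_lebesgue_const)
  qed
qed

end

lemma rep_linf_plus: "AE x in lebesgue. rep_linf (f + g) x = rep_linf f x + rep_linf g x"
  using rep_abs_linf[OF linf_fun_add[OF linf_fun_rep_linf linf_fun_rep_linf], of f g]
  by (simp add: plus_linf_def)

lemma rep_linf_minus: "AE x in lebesgue. rep_linf (f - g) x = rep_linf f x - rep_linf g x"
  using rep_abs_linf[OF linf_fun_diff[OF linf_fun_rep_linf linf_fun_rep_linf], of f g]
  by (simp add: minus_linf_def)

lemma rep_linf_times: "AE x in lebesgue. rep_linf (f * g) x = rep_linf f x * rep_linf g x"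
  using rep_abs_linf[OF linf_fun_mult[OF linf_fun_rep_linf linf_fun_rep_linf], of f g]
  by (simp add: times_linf_def)

lemma rep_linf_scaleR: "AE x in lebesgue. rep_linf (c *\<^sub>R f) x = c * rep_linf f x"
  using rep_abs_linf[OF linf_fun_scale[OF linf_fun_rep_linf], of c f]
  by (simp add: scaleR_linf_def)

lemma rep_linf_one: "AE x in lebesgue. rep_linf 1 x = 1"
  using rep_abs_linf[OF linf_fun_one] by (simp add: one_linf_def)

lemma norm_linf_le_iff: "norm f \<le> C \<longleftrightarrow> (AE x in lebesgue. \<bar>rep_linf f x\<bar> \<le> C)"
proof
  assume "norm f \<le> C"
  with AE_le_linf_norm[OF linf_fun_rep_linf, of f] show "AE x in lebesgue. \<bar>rep_linf f x\<bar> \<le> C"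
    by (auto simp: norm_linf.rep_eq elim: eventually_mono)
next
  assume "AE x in lebesgue. \<bar>rep_linf f x\<bar> \<le> C"
  then show "norm f \<le> C"
    by (simp add: norm_linf.rep_eq linf_norm_leI linf_fun_rep_linf)
qed

lemma AE_le_norm_linf: "AE x in lebesgue. \<bar>rep_linf f x\<bar> \<le> norm f"
  by (simp flip: norm_linf_le_iff)

text \<open>
  Order intervals with constant endpoints are balls around constants. Through this equivalence
  closedness of the tube and preservation of order under integration become statements about norms.
\<close>

lemma AE_interval_iff_norm:
  "(AE x in lebesgue. 0 \<le> rep_linf f x \<and> rep_linf f x \<le> m) \<longleftrightarrow> norm (f - (m / 2) *\<^sub>R 1) \<le> m / 2"
proof -
  have "AE x in lebesgue. rep_linf (f - (m / 2) *\<^sub>R 1) x = rep_linf f x - m / 2"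
    using rep_linf_minus[of f "(m / 2) *\<^sub>R 1"] rep_linf_scaleR[of "m / 2" 1] rep_linf_one
    by eventually_elim simp
  then have "AE x in lebesgue. \<bar>rep_linf (f - (m / 2) *\<^sub>R 1) x\<bar> \<le> m / 2 \<longleftrightarrow>
      0 \<le> rep_linf f x \<and> rep_linf f x \<le> m"
    by eventually_elim (unfold abs_le_iff, linarith)
  then show ?thesis
    unfolding norm_linf_le_iff by (rule eventually_subst[symmetric])
qed

text \<open>
  The countably many inequalities \<open>\<bar>X m - X n\<bar> \<le> \<parallel>X m - X n\<parallel>\<close> hold simultaneously outside one null
  set, and there the representatives form Cauchy sequences of reals.
\<close>

lemma linf_Cauchy_convergent:
  fixes X :: "nat \<Rightarrow> 'a::euclidean_space linf"
  assumes "Cauchy X"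
  shows "convergent X"
proof -
  define f where "f x = lim (\<lambda>n. rep_linf (X n) x)" for x
  have [measurable]: "rep_linf (X n) \<in> borel_measurable lebesgue" for n
    using linf_fun_rep_linf[of "X n"] by (simp add: linf_fun_def)
  have f_meas: "f \<in> borel_measurable lebesgue"
    unfolding f_def by measurable
  have "AE x in lebesgue. \<bar>rep_linf (X m) x - rep_linf (X n) x\<bar> \<le> norm (X m - X n)" for m n
    using AE_le_norm_linf[of "X m - X n"] rep_linf_minus[of "X m" "X n"]
    by eventually_elim simp
  then have all: "AE x in lebesgue. \<forall>m n. \<bar>rep_linf (X m) x - rep_linf (X n) x\<bar> \<le> norm (X m - X n)"
    by (simp add: AE_all_countable)
  have close: "AE x in lebesgue. \<bar>rep_linf (X m) x - f x\<bar> \<le> e"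
    if N: "\<And>n. n \<ge> N \<Longrightarrow> norm (X m - X n) \<le> e" for m N e
    using all
  proof eventually_elim
    case (elim x)
    have "Cauchy (\<lambda>n. rep_linf (X n) x)"
    proof (rule metric_CauchyI)
      fix e :: real assume "0 < e"
      from metric_CauchyD[OF assms this] obtain M
        where "\<And>m n. M \<le> m \<Longrightarrow> M \<le> n \<Longrightarrow> dist (X m) (X n) < e" by blast
      then show "\<exists>M. \<forall>m\<ge>M. \<forall>n\<ge>M. dist (rep_linf (X m) x) (rep_linf (X n) x) < e"
        by (auto simp: dist_norm intro!: exI[of _ M] intro: le_less_trans[OF elim[rule_format]])
    qed
    then have "(\<lambda>n. rep_linf (X n) x) \<longlonglongrightarrow> f x"
      unfolding f_def by (simp add: Cauchy_convergent_iff convergent_LIMSEQ_iff)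
    then have "(\<lambda>n. \<bar>rep_linf (X m) x - rep_linf (X n) x\<bar>) \<longlonglongrightarrow> \<bar>rep_linf (X m) x - f x\<bar>"
      by (intro tendsto_intros)
    moreover have "\<forall>n\<ge>N. \<bar>rep_linf (X m) x - rep_linf (X n) x\<bar> \<le> e"
      using elim N order_trans by blast
    ultimately show ?case
      by (blast intro: LIMSEQ_le_const2)
  qed
  have "linf_fun f"
  proof -
    from metric_CauchyD[OF assms zero_less_one] obtain M
      where M: "\<And>m n. M \<le> m \<Longrightarrow> M \<le> n \<Longrightarrow> dist (X m) (X n) < 1" by blast
    have "AE x in lebesgue. \<bar>rep_linf (X M) x - f x\<bar> \<le> 1"
      by (rule close[of M]) (use M in \<open>auto simp: dist_norm intro: less_imp_le\<close>)
    with AE_le_norm_linf[of "X M"] have "AE x in lebesgue. \<bar>f x\<bar> \<le> norm (X M) + 1"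
      by eventually_elim linarith
    with f_meas show ?thesis
      by (auto simp: linf_fun_AE_iff)
  qed
  have "X \<longlonglongrightarrow> abs_linf f"
  proof (rule metric_LIMSEQ_I)
    fix e :: real assume "0 < e"
    then have "0 < e / 2" by simp
    from metric_CauchyD[OF assms this] obtain M
      where M: "\<And>m n. M \<le> m \<Longrightarrow> M \<le> n \<Longrightarrow> dist (X m) (X n) < e / 2" by blast
    have "dist (X m) (abs_linf f) < e" if "M \<le> m" for m
    proof -
      have "AE x in lebesgue. \<bar>rep_linf (X m) x - f x\<bar> \<le> e / 2"
        by (rule close[of M]) (use M that in \<open>auto simp: dist_norm intro: less_imp_le\<close>)
      with rep_linf_minus[of "X m" "abs_linf f"] rep_abs_linf[OF \<open>linf_fun f\<close>]
      have "AE x in lebesgue. \<bar>rep_linf (X m - abs_linf f) x\<bar> \<le> e / 2"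
        by eventually_elim simp
      then have "norm (X m - abs_linf f) \<le> e / 2"
        by (simp only: norm_linf_le_iff)
      then show ?thesis
        using \<open>0 < e\<close> by (simp add: dist_norm)
    qed
    then show "\<exists>M. \<forall>m\<ge>M. dist (X m) (abs_linf f) < e" by blast
  qed
  then show ?thesis by (rule convergentI)
qed

instance linf :: (euclidean_space) banach
  by standard (rule linf_Cauchy_convergent)

lemma bounded_linear_comp0: "bounded_linear comp0"
  by (rule bounded_linear_intro[where K = 1])
    (simp_all add: plus_linf2_def scaleR_linf2_def norm_linf2_def)

lemma bounded_linear_comp1: "bounded_linear comp1"
  by (rule bounded_linear_intro[where K = 1])
    (simp_all add: plus_linf2_def scaleR_linf2_def norm_linf2_def)

lemma norm_linf2_le_iff: "norm u \<le> C \<longleftrightarrow> norm (comp0 u) \<le> C \<and> norm (comp1 u) \<le> C"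
  by (simp add: norm_linf2_def)

instance linf2 :: (euclidean_space) banach
proof
  fix X :: "nat \<Rightarrow> 'a linf2"
  assume "Cauchy X"
  then have "Cauchy (\<lambda>n. comp0 (X n))" "Cauchy (\<lambda>n. comp1 (X n))"
    using bounded_linear.Cauchy bounded_linear_comp0 bounded_linear_comp1 by blast+
  then obtain l0 l1 where "(\<lambda>n. comp0 (X n)) \<longlonglongrightarrow> l0" "(\<lambda>n. comp1 (X n)) \<longlonglongrightarrow> l1"
    using Cauchy_convergent convergent_def by blast
  then have "(\<lambda>n. norm (comp0 (X n) - l0)) \<longlonglongrightarrow> 0" "(\<lambda>n. norm (comp1 (X n) - l1)) \<longlonglongrightarrow> 0"
    by (auto intro: tendsto_norm_zero LIM_zero)
  from tendsto_max[OF this] have "(\<lambda>n. norm (X n - Linf2 l0 l1)) \<longlonglongrightarrow> 0"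
    by (simp add: norm_linf2_def minus_linf2_def)
  then have "X \<longlonglongrightarrow> Linf2 l0 l1"
    by (rule LIM_zero_cancel[OF tendsto_norm_zero_cancel])
  then show "convergent X" by (rule convergentI)
qed

section \<open>Convolution as an operator\<close>

text \<open>
  Reflections are affine maps whose linear part multiplies every coordinate by \<open>- 1\<close>, hence they preserve
  the Lebesgue measure.
\<close>

lemma measurable_reflection: "(\<lambda>y. x - y) \<in> lebesgue \<rightarrow>\<^sub>M lebesgue"
  and distr_lebesgue_reflection: "distr lebesgue lebesgue (\<lambda>y. x - y) = lebesgue"
  for x :: "'a::euclidean_space"
proof -
  have eq: "(\<lambda>y. x + (\<Sum>j\<in>Basis. ((- 1) * (y \<bullet> j)) *\<^sub>R j)) = (\<lambda>y. x - y)"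
    by (auto simp: sum_negf euclidean_representation)
  show "(\<lambda>y. x - y) \<in> lebesgue \<rightarrow>\<^sub>M lebesgue"
    using lebesgue_affine_measurable[of "\<lambda>_. - 1" x] unfolding eq by simp
  show "distr lebesgue lebesgue (\<lambda>y. x - y) = lebesgue"
    using lebesgue_affine_euclidean[of "\<lambda>_. - 1" x] unfolding eq by (simp add: density_1)
qed

lemma AE_reflection:
  assumes "AE y in lebesgue. P y"
  shows "AE y in lebesgue. P (x - y :: 'a::euclidean_space)"
proof (rule AE_distrD[OF measurable_reflection[of x]])
  show "AE y in distr lebesgue lebesgue (\<lambda>y. x - y). P y"
    unfolding distr_lebesgue_reflection by (rule assms)
qed

lemma integrable_reflection:
  fixes a :: "'a::euclidean_space \<Rightarrow> real"
  assumes "integrable lebesgue a"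
  shows "integrable lebesgue (\<lambda>y. a (x - y))"
  using assms integrable_distr[OF measurable_reflection[of x], of a]
  by (simp add: distr_lebesgue_reflection)

lemma integral_reflection:
  fixes a :: "'a::euclidean_space \<Rightarrow> real"
  assumes "a \<in> borel_measurable lebesgue"
  shows "(\<integral>y. a (x - y) \<partial>lebesgue) = (\<integral>y. a y \<partial>lebesgue)"
  using integral_distr[OF measurable_reflection[of x] assms]
  by (simp add: distr_lebesgue_reflection)

lemma borel_measurable_convolution_integrand:
  fixes a f :: "'a::euclidean_space \<Rightarrow> real"
  assumes "a \<in> borel_measurable lebesgue" "f \<in> borel_measurable lebesgue"
  shows "(\<lambda>y. a (x - y) * f y) \<in> borel_measurable lebesgue"
  by (rule borel_measurable_times[OF measurable_compose[OF measurable_reflection assms(1)] assms(2)])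

lemma integrable_convolution:
  assumes a: "integrable lebesgue a" and f: "linf_fun f"
  shows "integrable lebesgue (\<lambda>y. a (x - y) * f y)"
proof (rule Bochner_Integration.integrable_bound)
  show "integrable lebesgue (\<lambda>y. linf_norm f * a (x - y))"
    using integrable_reflection[OF a] by simp
  show "(\<lambda>y. a (x - y) * f y) \<in> borel_measurable lebesgue"
    using a f by (intro borel_measurable_convolution_integrand) (auto simp: linf_fun_def)
  show "AE y in lebesgue. norm (a (x - y) * f y) \<le> norm (linf_norm f * a (x - y))"
    using AE_le_linf_norm[OF f]
    by eventually_elim (simp add: abs_mult mult.commute[of "\<bar>a _\<bar>"] mult_right_mono)
qed

lemma convolution_cong_AE:
  assumes a: "a \<in> borel_measurable lebesgue"
    and f: "f \<in> borel_measurable lebesgue" "g \<in> borel_measurable lebesgue"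
    and "AE x in lebesgue. f x = g x"
  shows "convolution a f = convolution a g"
  unfolding convolution_def
proof (intro ext integral_cong_AE)
  fix x
  show "(\<lambda>y. a (x - y) * f y) \<in> borel_measurable lebesgue"
    and "(\<lambda>y. a (x - y) * g y) \<in> borel_measurable lebesgue"
    using a f by (auto intro: borel_measurable_convolution_integrand)
  show "AE y in lebesgue. a (x - y) * f y = a (x - y) * g y"
    using assms(4) by eventually_elim simp
qed

text \<open>
  Lebesgue measure on a product is not the product of the completed measures, so Fubini's measurability
  theorem is applied to Borel functions that agree with \<open>a\<close> and \<open>f\<close> almost everywhere. Changing both
  factors on null sets leaves the convolution unchanged at every single point.
\<close>

lemma borel_measurable_convolution:
  assumes a: "a \<in> borel_measurable lebesgue" and f: "f \<in> borel_measurable lebesgue"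
  shows "convolution a f \<in> borel_measurable lebesgue"
proof -
  obtain a' where a'[measurable]: "a' \<in> borel_measurable borel" and "AE x in lborel. a x = a' x"
    using completion_ex_borel_measurable_real[OF a] by auto
  then have aa': "AE x in lebesgue. a x = a' x"
    by (simp add: AE_completion)
  obtain f' where f'[measurable]: "f' \<in> borel_measurable borel" and "AE x in lborel. f x = f' x"
    using completion_ex_borel_measurable_real[OF f] by auto
  then have ff': "AE x in lebesgue. f x = f' x"
    by (simp add: AE_completion)
  have "convolution a f x = (\<integral>y. a' (x - y) * f' y \<partial>lborel)" for x
  proof -
    have "convolution a f x = (\<integral>y. a' (x - y) * f' y \<partial>lebesgue)"
      unfolding convolution_def
    proof (rule integral_cong_AE)
      show "(\<lambda>y. a (x - y) * f y) \<in> borel_measurable lebesgue"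
        using a f by (rule borel_measurable_convolution_integrand)
      show "(\<lambda>y. a' (x - y) * f' y) \<in> borel_measurable lebesgue"
        by (intro measurable_completion) measurable
      show "AE y in lebesgue. a (x - y) * f y = a' (x - y) * f' y"
        using AE_reflection[OF aa', of x] ff' by eventually_elim simp
    qed
    also have "\<dots> = (\<integral>y. a' (x - y) * f' y \<partial>lborel)"
      by (intro integral_completion) measurable
    finally show ?thesis .
  qed
  then have "convolution a f = (\<lambda>x. \<integral>y. a' (x - y) * f' y \<partial>lborel)"
    by auto
  moreover have "(\<lambda>x. \<integral>y. a' (x - y) * f' y \<partial>lborel) \<in> borel_measurable lborel"
    by measurable
  ultimately show ?thesis
    by (simp add: measurable_completion)
qed

lemma convolution_bounds:
  fixes a f :: "'a::euclidean_space \<Rightarrow> real"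
  assumes a: "\<And>x. 0 \<le> a x" "integrable lebesgue a"
    and f: "linf_fun f" "AE x in lebesgue. c \<le> f x \<and> f x \<le> d"
  shows "c * (\<integral>y. a y \<partial>lebesgue) \<le> convolution a f x \<and>
    convolution a f x \<le> d * (\<integral>y. a y \<partial>lebesgue)"
proof -
  have *: "(\<integral>y. k * a (x - y) \<partial>lebesgue) = k * (\<integral>y. a y \<partial>lebesgue)" for k
    using integral_reflection[of a x] a(2) by simp
  note int = integrable_convolution[OF a(2) f(1)] integrable_mult_right[OF integrable_reflection[OF a(2)]]
  have le: "AE y in lebesgue. c * a (x - y) \<le> a (x - y) * f y"
    and ge: "AE y in lebesgue. a (x - y) * f y \<le> d * a (x - y)"
    using f(2) by (eventually_elim, simp add: a mult.commute mult_right_mono)+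
  show ?thesis
    unfolding *[symmetric] convolution_def
    by (intro conjI integral_mono_AE int le ge)
qed

lemma linf_fun_convolution:
  assumes a: "\<And>x. 0 \<le> a x" "integrable lebesgue a" and f: "linf_fun f"
  shows "linf_fun (convolution a f)"
proof -
  have "AE x in lebesgue. - linf_norm f \<le> f x \<and> f x \<le> linf_norm f"
    using AE_le_linf_norm[OF f] by eventually_elim auto
  from convolution_bounds[OF a f this]
  have "\<bar>convolution a f x\<bar> \<le> linf_norm f * (\<integral>y. a y \<partial>lebesgue)" for x
    by (simp add: abs_le_iff minus_le_iff)
  then show ?thesis
    using borel_measurable_convolution[of a f] a f by (auto simp: linf_fun_AE_iff)
qed

definition conv_linf :: "('a::euclidean_space \<Rightarrow> real) \<Rightarrow> 'a linf \<Rightarrow> 'a linf" where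
  "conv_linf a f = abs_linf (convolution a (rep_linf f))"

context
  fixes a :: "'a::euclidean_space \<Rightarrow> real"
  assumes a: "\<And>x. 0 \<le> a x" "integrable lebesgue a"
begin

lemma rep_conv_linf: "AE x in lebesgue. rep_linf (conv_linf a f) x = convolution a (rep_linf f) x"
  unfolding conv_linf_def by (intro rep_abs_linf linf_fun_convolution a linf_fun_rep_linf)

lemma conv_linf_diff: "conv_linf a (f - g) = conv_linf a f - conv_linf a g"
proof -
  have m: "rep_linf h \<in> borel_measurable lebesgue" for h :: "'a linf"
    using linf_fun_rep_linf[of h] by (simp add: linf_fun_def)
  have "convolution a (rep_linf (f - g)) = convolution a (\<lambda>x. rep_linf f x - rep_linf g x)"
    using a m rep_linf_minus by (intro convolution_cong_AE) auto
  also have "\<dots> = (\<lambda>x. convolution a (rep_linf f) x - convolution a (rep_linf g) x)"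
    unfolding convolution_def
    by (simp add: right_diff_distrib integrable_convolution a linf_fun_rep_linf)
  finally have "AE x in lebesgue. rep_linf (conv_linf a (f - g)) x =
      convolution a (rep_linf f) x - convolution a (rep_linf g) x"
    using rep_conv_linf[of "f - g"] by simp
  then show ?thesis
    unfolding linf_eq_iff
    using rep_conv_linf[of f] rep_conv_linf[of g] rep_linf_minus[of "conv_linf a f" "conv_linf a g"]
    by eventually_elim simp
qed

lemma AE_conv_linf_bounds:
  assumes "AE x in lebesgue. c \<le> rep_linf f x \<and> rep_linf f x \<le> d"
  shows "AE x in lebesgue. c * (\<integral>y. a y \<partial>lebesgue) \<le> rep_linf (conv_linf a f) x \<and>
    rep_linf (conv_linf a f) x \<le> d * (\<integral>y. a y \<partial>lebesgue)"
  using rep_conv_linf[of f]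
  by eventually_elim (simp add: convolution_bounds[OF a linf_fun_rep_linf assms])

lemma norm_conv_linf: "norm (conv_linf a f) \<le> (\<integral>y. a y \<partial>lebesgue) * norm f"
proof -
  have "AE x in lebesgue. - norm f \<le> rep_linf f x \<and> rep_linf f x \<le> norm f"
    using AE_le_norm_linf[of f] by eventually_elim auto
  from AE_conv_linf_bounds[OF this] show ?thesis
    unfolding norm_linf_le_iff by eventually_elim (auto simp: abs_le_iff mult.commute)
qed

end

lemma linf_fun_exp_uminus:
  assumes "linf_fun f"
  shows "linf_fun (\<lambda>x. exp (- f x))"
proof -
  have "AE x in lebesgue. \<bar>exp (- f x)\<bar> \<le> exp (linf_norm f)"
    using AE_le_linf_norm[OF assms] by eventually_elim auto
  moreover have "(\<lambda>x. exp (- f x)) \<in> borel_measurable lebesgue"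
    using assms by (auto simp: linf_fun_AE_iff)
  ultimately show ?thesis
    unfolding linf_fun_AE_iff by blast
qed

definition exp_uminus_linf :: "'a::euclidean_space linf \<Rightarrow> 'a linf" where
  "exp_uminus_linf f = abs_linf (\<lambda>x. exp (- rep_linf f x))"

lemma rep_exp_uminus_linf:
  "AE x in lebesgue. rep_linf (exp_uminus_linf f) x = exp (- rep_linf f x)"
  unfolding exp_uminus_linf_def by (intro rep_abs_linf linf_fun_exp_uminus linf_fun_rep_linf)

section \<open>The kinetic vector field\<close>

definition nonneg_linf :: "'a::euclidean_space linf \<Rightarrow> bool" where
  "nonneg_linf f \<longleftrightarrow> (AE x in lebesgue. 0 \<le> rep_linf f x)"

lemma nonneg_linf_scaleR:
  assumes "nonneg_linf f" "0 \<le> c"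
  shows "nonneg_linf (c *\<^sub>R f)"
  using assms rep_linf_scaleR[of c f] unfolding nonneg_linf_def
  by (auto elim!: eventually_elim2)

lemma nonneg_linf_interval:
  assumes "nonneg_linf f"
  shows "AE x in lebesgue. 0 \<le> rep_linf f x \<and> rep_linf f x \<le> norm f"
  using assms[unfolded nonneg_linf_def] AE_le_norm_linf[of f] by eventually_elim simp

lemma positive_linf2_iff: "positive_linf2 u \<longleftrightarrow> nonneg_linf (comp0 u) \<and> nonneg_linf (comp1 u)"
  by (simp add: positive_linf2_def nonneg_linf_def)

lemma exp_uminus_linf_bounds:
  assumes "nonneg_linf g"
  shows "AE x in lebesgue. 0 \<le> rep_linf (exp_uminus_linf g) x \<and> rep_linf (exp_uminus_linf g) x \<le> 1"
  using assms[unfolded nonneg_linf_def] rep_exp_uminus_linf[of g] by eventually_elim simp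

lemma norm_exp_uminus_linf:
  assumes "nonneg_linf g"
  shows "norm (exp_uminus_linf g) \<le> 1"
  unfolding norm_linf_le_iff using exp_uminus_linf_bounds[OF assms] by eventually_elim simp

lemma exp_uminus_lipschitz:
  fixes s t :: real
  assumes "0 \<le> s" "0 \<le> t"
  shows "\<bar>exp (- s) - exp (- t)\<bar> \<le> \<bar>s - t\<bar>"
  using assms
proof (induction s t rule: linorder_wlog)
  case (le s t)
  have "exp (- s) - exp (- t) = exp (- s) * (1 - exp (- (t - s)))"
    by (simp add: right_diff_distrib flip: exp_add)
  also have "1 - exp (- (t - s)) \<le> t - s"
    using exp_ge_add_one_self[of "- (t - s)"] by linarith
  then have "exp (- s) * (1 - exp (- (t - s))) \<le> 1 * (t - s)"
    using le by (intro mult_mono) auto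
  finally show ?case using le by simp
qed (simp add: abs_minus_commute)

text \<open>
  Positivity makes the Lipschitz constant independent of the size of \<open>g\<close> and \<open>h\<close>.
\<close>

lemma exp_uminus_linf_lipschitz:
  assumes "nonneg_linf g" "nonneg_linf h"
  shows "norm (exp_uminus_linf g - exp_uminus_linf h) \<le> norm (g - h)"
  unfolding norm_linf_le_iff
  using assms[unfolded nonneg_linf_def] rep_exp_uminus_linf[of g] rep_exp_uminus_linf[of h]
    rep_linf_minus[of "exp_uminus_linf g" "exp_uminus_linf h"] rep_linf_minus[of g h]
    AE_le_norm_linf[of "g - h"]
proof eventually_elim
  case (elim x)
  then show ?case
    using exp_uminus_lipschitz[of "rep_linf g x" "rep_linf h x"] by simp
qed

lemma nonneg_conv_linf:
  assumes a: "\<And>x. 0 \<le> a x" "integrable lebesgue a" and f: "nonneg_linf f"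
  shows "nonneg_linf (conv_linf a f)"
  using AE_conv_linf_bounds[OF a nonneg_linf_interval[OF f]]
  unfolding nonneg_linf_def by eventually_elim simp

definition kinetic_linf ::
    "('a::euclidean_space \<Rightarrow> real) \<Rightarrow> ('a \<Rightarrow> real) \<Rightarrow> 'a linf \<Rightarrow> 'a linf \<Rightarrow> 'a linf" where
  "kinetic_linf a \<phi> f g =
     conv_linf a f * exp_uminus_linf (conv_linf \<phi> g)
     - f * conv_linf a (exp_uminus_linf (conv_linf \<phi> g))"

context
  fixes a \<phi> :: "'a::euclidean_space \<Rightarrow> real"
  assumes a: "\<And>x. 0 \<le> a x" "integrable lebesgue a"
    and \<phi>: "\<And>x. 0 \<le> \<phi> x" "integrable lebesgue \<phi>"
begin

text \<open>
  The operators on classes compute the pointwise right-hand side. The inner exponential is only known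
  almost everywhere, which suffices because it enters through a convolution.
\<close>

lemma rep_kinetic_linf:
  "AE x in lebesgue. rep_linf (kinetic_linf a \<phi> f g) x =
     kinetic_rhs a \<phi> (rep_linf f) (rep_linf g) x"
proof -
  let ?E = "exp_uminus_linf (conv_linf \<phi> g)"
  have E: "AE x in lebesgue. rep_linf ?E x = exp (- convolution \<phi> (rep_linf g) x)"
    using rep_exp_uminus_linf[of "conv_linf \<phi> g"] rep_conv_linf[OF \<phi>, of g]
    by eventually_elim simp
  have m: "linf_fun (\<lambda>x. exp (- convolution \<phi> (rep_linf g) x))"
    by (intro linf_fun_exp_uminus linf_fun_convolution \<phi> linf_fun_rep_linf)
  have "convolution a (rep_linf ?E) = convolution a (\<lambda>x. exp (- convolution \<phi> (rep_linf g) x))"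
    using a m E linf_fun_rep_linf[of ?E] by (intro convolution_cong_AE) (auto simp: linf_fun_def)
  then have "AE x in lebesgue. rep_linf (conv_linf a ?E) x =
      convolution a (\<lambda>x. exp (- convolution \<phi> (rep_linf g) x)) x"
    using rep_conv_linf[OF a, of ?E] by simp
  then show ?thesis
    unfolding kinetic_linf_def kinetic_rhs_def
    using E rep_conv_linf[OF a, of f] rep_linf_times[of "conv_linf a f" ?E]
      rep_linf_times[of f "conv_linf a ?E"]
      rep_linf_minus[of "conv_linf a f * ?E" "f * conv_linf a ?E"]
    by eventually_elim simp
qed

text \<open>
  The gain and the loss term are both bilinear in \<open>f\<close> and the exponential. Each difference of products
  is split so that \<open>f'\<close> multiplies the change of the exponential, whence the bound \<open>R\<close> on \<open>f'\<close>. The two terms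
  obey the same estimate, whence the factor \<open>2\<close>.
\<close>

lemma kinetic_linf_lipschitz:
  assumes g: "nonneg_linf g" "nonneg_linf g'" and f': "norm f' \<le> R"
  shows "norm (kinetic_linf a \<phi> f g - kinetic_linf a \<phi> f' g') \<le>
    2 * (\<integral>x. a x \<partial>lebesgue) * (norm (f - f') + R * ((\<integral>x. \<phi> x \<partial>lebesgue) * norm (g - g')))"
proof -
  define \<alpha> p where "\<alpha> = (\<integral>x. a x \<partial>lebesgue)" and "p = (\<integral>x. \<phi> x \<partial>lebesgue)"
  have \<alpha>: "0 \<le> \<alpha>" and p: "0 \<le> p"
    using a \<phi> by (simp_all add: \<alpha>_def p_def)
  have R: "0 \<le> R"
    using f' norm_ge_zero order_trans by blast
  define E E' where "E = exp_uminus_linf (conv_linf \<phi> g)" and "E' = exp_uminus_linf (conv_linf \<phi> g')"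
  have nn: "nonneg_linf (conv_linf \<phi> g)" "nonneg_linf (conv_linf \<phi> g')"
    using nonneg_conv_linf[OF \<phi>] g by auto
  have E: "norm E \<le> 1"
    unfolding E_def by (rule norm_exp_uminus_linf[OF nn(1)])
  have "norm (E - E') \<le> norm (conv_linf \<phi> (g - g'))"
    unfolding E_def E'_def conv_linf_diff[OF \<phi>] by (rule exp_uminus_linf_lipschitz[OF nn])
  also have "\<dots> \<le> p * norm (g - g')"
    unfolding p_def by (rule norm_conv_linf[OF \<phi>])
  finally have EE': "norm (E - E') \<le> p * norm (g - g')" .
  have conv: "norm (conv_linf a h) \<le> \<alpha> * c" if "norm h \<le> c" for h c
    using norm_conv_linf[OF a, of h] mult_left_mono[OF that \<alpha>] by (simp add: \<alpha>_def)
  have mult: "norm (h * k) \<le> c * d" if "norm h \<le> c" "norm k \<le> d" for h k :: "'a linf" and c d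
    using norm_mult_ineq[of h k] mult_mono'[OF that] by simp
  have "kinetic_linf a \<phi> f g - kinetic_linf a \<phi> f' g' =
      conv_linf a (f - f') * E + conv_linf a f' * (E - E')
      - ((f - f') * conv_linf a E + f' * conv_linf a (E - E'))"
    unfolding kinetic_linf_def E_def[symmetric] E'_def[symmetric] conv_linf_diff[OF a]
    by (simp add: algebra_simps)
  also have "norm \<dots> \<le> \<alpha> * norm (f - f') * 1 + \<alpha> * R * (p * norm (g - g'))
      + (norm (f - f') * (\<alpha> * 1) + R * (\<alpha> * (p * norm (g - g'))))"
    by (intro order_trans[OF norm_triangle_ineq4] order_trans[OF norm_triangle_ineq] add_mono
        mult conv E EE' f' order_refl)
  also have "\<dots> = 2 * \<alpha> * (norm (f - f') + R * (p * norm (g - g')))"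
    by (simp add: algebra_simps)
  finally show ?thesis
    by (simp add: \<alpha>_def p_def)
qed

text \<open>
  With \<open>E = exp (- \<phi> * g) \<in> [0, 1]\<close>, the expression equals \<open>(a * f) E + f (c - a * E)\<close>, where
  \<open>0 \<le> a * E \<le> \<alpha> \<le> c\<close> for the integral \<open>\<alpha>\<close> of \<open>a\<close>. Both summands are nonnegative; the first is at most
  \<open>\<alpha> m\<close> and the second at most \<open>c m\<close>.
\<close>

lemma kinetic_linf_bounds:
  assumes f: "AE x in lebesgue. 0 \<le> rep_linf f x \<and> rep_linf f x \<le> m"
    and g: "nonneg_linf g" and c: "(\<integral>x. a x \<partial>lebesgue) \<le> c"
  shows "AE x in lebesgue. 0 \<le> rep_linf (kinetic_linf a \<phi> f g + c *\<^sub>R f) x \<and>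
    rep_linf (kinetic_linf a \<phi> f g + c *\<^sub>R f) x \<le> (c + (\<integral>x. a x \<partial>lebesgue)) * m"
proof -
  let ?E = "exp_uminus_linf (conv_linf \<phi> g)"
  let ?\<alpha> = "\<integral>x. a x \<partial>lebesgue"
  have E: "AE x in lebesgue. 0 \<le> rep_linf ?E x \<and> rep_linf ?E x \<le> 1"
    by (intro exp_uminus_linf_bounds nonneg_conv_linf \<phi> g)
  show ?thesis
    unfolding kinetic_linf_def
    using f E AE_conv_linf_bounds[OF a f] AE_conv_linf_bounds[OF a E]
      rep_linf_times[of "conv_linf a f" ?E] rep_linf_times[of f "conv_linf a ?E"]
      rep_linf_minus[of "conv_linf a f * ?E" "f * conv_linf a ?E"] rep_linf_scaleR[of c f]
      rep_linf_plus[of "conv_linf a f * ?E - f * conv_linf a ?E" "c *\<^sub>R f"]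
  proof eventually_elim
    case (elim x)
    let ?f = "rep_linf f x" and ?e = "rep_linf ?E x"
    let ?A = "rep_linf (conv_linf a f) x" and ?B = "rep_linf (conv_linf a ?E) x"
    have eq: "rep_linf (conv_linf a f * ?E - f * conv_linf a ?E + c *\<^sub>R f) x = ?A * ?e + ?f * (c - ?B)"
      using elim by (simp add: algebra_simps)
    have "0 \<le> ?A * ?e" "0 \<le> ?f * (c - ?B)"
      using elim c by simp_all
    moreover have "?A * ?e \<le> m * ?\<alpha> * 1"
      by (rule mult_mono') (use elim in simp_all)
    moreover have "?f * (c - ?B) \<le> m * c"
      by (rule mult_mono) (use elim c in auto)
    ultimately show ?case
      unfolding eq by (simp add: algebra_simps)
  qed
qed

end

lemma AE_interval_scaleR:
  assumes "AE x in lebesgue. 0 \<le> rep_linf f x \<and> rep_linf f x \<le> m" "0 \<le> c"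
  shows "AE x in lebesgue. 0 \<le> rep_linf (c *\<^sub>R f) x \<and> rep_linf (c *\<^sub>R f) x \<le> c * m"
  using assms(1) rep_linf_scaleR[of c f]
  by eventually_elim (simp add: assms(2) mult_left_mono)

text \<open>
  Integration of order bounds. In terms of balls, the centre \<open>p s / 2\<close> moves with velocity \<open>q s / 2\<close>, the
  radius grows at the same rate, and the distance of \<open>x s\<close> from the centre grows at most that fast.
\<close>

lemma AE_interval_of_derivative:
  fixes x :: "real \<Rightarrow> 'a::euclidean_space linf"
  assumes t: "0 \<le> t"
    and x: "\<And>s. 0 \<le> s \<Longrightarrow> (x has_vector_derivative y s) (at s within {0..})"
    and p: "\<And>s. (p has_real_derivative q s) (at s)"
    and y: "\<And>s. 0 \<le> s \<Longrightarrow> AE z in lebesgue. 0 \<le> rep_linf (y s) z \<and> rep_linf (y s) z \<le> q s"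
    and 0: "AE z in lebesgue. 0 \<le> rep_linf (x 0) z \<and> rep_linf (x 0) z \<le> p 0"
  shows "AE z in lebesgue. 0 \<le> rep_linf (x t) z \<and> rep_linf (x t) z \<le> p t"
proof -
  let ?c = "\<lambda>s. x s - (p s / 2) *\<^sub>R 1"
  have p': "((\<lambda>s. p s / 2) has_real_derivative q s / 2) (at s within {0..})" for s
    by (intro DERIV_cdivide DERIV_subset[OF p]) simp
  have "norm (?c t - ?c 0) \<le> p t / 2 - p 0 / 2"
  proof (rule norm_increment_le[OF t])
    fix s :: real assume "0 \<le> s"
    show "(?c has_vector_derivative y s - (q s / 2) *\<^sub>R 1) (at s within {0..})"
      using has_vector_derivative_scaleR[OF p' has_vector_derivative_const] x[OF \<open>0 \<le> s\<close>]
      by (intro has_vector_derivative_diff) simp_all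
    show "((\<lambda>s. p s / 2) has_vector_derivative q s / 2) (at s within {0..})"
      using p' by (simp add: has_real_derivative_iff_has_vector_derivative)
    show "norm (y s - (q s / 2) *\<^sub>R 1) \<le> q s / 2"
      using y[OF \<open>0 \<le> s\<close>] by (simp only: AE_interval_iff_norm)
  qed
  moreover have "norm (?c 0) \<le> p 0 / 2"
    using 0 by (simp only: AE_interval_iff_norm)
  ultimately have "norm (?c t) \<le> p t / 2"
    using norm_triangle_sub[of "?c t" "?c 0"] by linarith
  then show ?thesis by (simp only: AE_interval_iff_norm)
qed

section \<open>Existence and uniqueness of positive solutions\<close>

locale kinetic_system =
  fixes a0 a1 \<phi>0 \<phi>1 :: "'a::euclidean_space \<Rightarrow> real"
  assumes a0: "\<And>x. 0 \<le> a0 x" "integrable lebesgue a0"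
    and a1: "\<And>x. 0 \<le> a1 x" "integrable lebesgue a1"
    and \<phi>0: "\<And>x. 0 \<le> \<phi>0 x" "integrable lebesgue \<phi>0"
    and \<phi>1: "\<And>x. 0 \<le> \<phi>1 x" "integrable lebesgue \<phi>1"
begin

definition kinetic_field :: "'a linf2 \<Rightarrow> 'a linf2" where
  "kinetic_field u = Linf2 (kinetic_linf a0 \<phi>0 (comp0 u) (comp1 u)) (kinetic_linf a1 \<phi>1 (comp1 u) (comp0 u))"

lemma kinetic_field_lipschitz:
  obtains L where "0 \<le> L"
    and "\<And>u v. positive_linf2 u \<Longrightarrow> positive_linf2 v \<Longrightarrow> norm u \<le> R \<Longrightarrow> norm v \<le> R \<Longrightarrow>
      norm (kinetic_field u - kinetic_field v) \<le> L * norm (u - v)"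
proof (cases "0 \<le> R")
  case True
  define C where "C a \<phi> = 2 * (\<integral>x. a x \<partial>lebesgue) * (1 + R * (\<integral>x. \<phi> x \<partial>lebesgue))"
    for a \<phi> :: "'a \<Rightarrow> real"
  have C: "0 \<le> C a0 \<phi>0" "0 \<le> C a1 \<phi>1"
    using True a0 a1 \<phi>0 \<phi>1 by (simp_all add: C_def)
  show thesis
  proof (rule that[of "C a0 \<phi>0 + C a1 \<phi>1"])
    show "0 \<le> C a0 \<phi>0 + C a1 \<phi>1" using C by simp
    fix u v :: "'a linf2"
    assume pos: "positive_linf2 u" "positive_linf2 v" and R: "norm u \<le> R" "norm v \<le> R"
    define d where "d = norm (u - v)"
    have d: "norm (comp0 u - comp0 v) \<le> d" "norm (comp1 u - comp1 v) \<le> d"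
      by (simp_all add: d_def norm_linf2_def minus_linf2_def)
    have "norm (kinetic_linf a \<phi> f g - kinetic_linf a \<phi> f' g') \<le> C a \<phi> * d"
      if a: "\<And>x. 0 \<le> a x" "integrable lebesgue a"
        and \<phi>: "\<And>x. 0 \<le> \<phi> x" "integrable lebesgue \<phi>"
        and g: "nonneg_linf g" "nonneg_linf g'" "norm f' \<le> R"
        and le: "norm (f - f') \<le> d" "norm (g - g') \<le> d" for a \<phi> f f' g g'
    proof -
      have "norm (kinetic_linf a \<phi> f g - kinetic_linf a \<phi> f' g') \<le>
          2 * (\<integral>x. a x \<partial>lebesgue) * (norm (f - f') + R * ((\<integral>x. \<phi> x \<partial>lebesgue) * norm (g - g')))"
        by (rule kinetic_linf_lipschitz[OF a \<phi> g])
      also have "\<dots> \<le> 2 * (\<integral>x. a x \<partial>lebesgue) * (d + R * ((\<integral>x. \<phi> x \<partial>lebesgue) * d))"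
        using True a \<phi> le by (intro mult_left_mono add_mono) auto
      also have "\<dots> = C a \<phi> * d"
        by (simp add: C_def algebra_simps)
      finally show ?thesis .
    qed
    from this[OF a0 \<phi>0] this[OF a1 \<phi>1]
    have le: "norm (comp0 (kinetic_field u - kinetic_field v)) \<le> C a0 \<phi>0 * d"
        "norm (comp1 (kinetic_field u - kinetic_field v)) \<le> C a1 \<phi>1 * d"
      using pos R d by (simp_all add: kinetic_field_def minus_linf2_def positive_linf2_iff norm_linf2_le_iff)
    have "0 \<le> d" by (simp add: d_def)
    with C have "0 \<le> C a0 \<phi>0 * d" "0 \<le> C a1 \<phi>1 * d" by simp_all
    with le show "norm (kinetic_field u - kinetic_field v) \<le> (C a0 \<phi>0 + C a1 \<phi>1) * norm (u - v)"
      unfolding d_def[symmetric] norm_linf2_le_iff distrib_right by linarith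
  qed
next
  case False
  then have "\<not> norm u \<le> R" for u :: "'a linf2"
    using norm_ge_zero[of u] by linarith
  then show thesis using that[of 0] by simp
qed

lemma continuous_on_kinetic_field: "continuous_on {u. positive_linf2 u} kinetic_field"
  unfolding continuous_on_iff
proof (intro ballI allI impI)
  fix u :: "'a linf2" and e :: real
  assume u: "u \<in> {u. positive_linf2 u}" and e: "0 < e"
  obtain L where L: "0 \<le> L"
    and lip: "\<And>w v. positive_linf2 w \<Longrightarrow> positive_linf2 v \<Longrightarrow> norm w \<le> norm u + 1 \<Longrightarrow>
      norm v \<le> norm u + 1 \<Longrightarrow> norm (kinetic_field w - kinetic_field v) \<le> L * norm (w - v)"
    using kinetic_field_lipschitz[of "norm u + 1"] by blast
  show "\<exists>d>0. \<forall>v\<in>{u. positive_linf2 u}. dist v u < d \<longrightarrow> dist (kinetic_field v) (kinetic_field u) < e"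
  proof (intro exI[of _ "min 1 (e / (L + 1))"] conjI ballI impI)
    show "0 < min 1 (e / (L + 1))" using e L by simp
    fix v assume v: "v \<in> {u. positive_linf2 u}" and d: "dist v u < min 1 (e / (L + 1))"
    then have "norm v \<le> norm u + 1"
      using norm_triangle_ineq2[of v u] by (simp add: dist_norm)
    then have "dist (kinetic_field v) (kinetic_field u) \<le> L * dist v u"
      using u v lip[of v u] by (simp add: dist_norm)
    also have "\<dots> \<le> (L + 1) * dist v u"
      by (intro mult_right_mono) auto
    also have "\<dots> < e"
      using d L by (simp add: field_simps)
    finally show "dist (kinetic_field v) (kinetic_field u) < e" .
  qed
qed

text \<open>
  For positive curves the continuity of the derivative is automatic, since the field is continuous
  on the positive cone.
\<close>

lemma positive_global_solution_iff:
  "positive_global_solution a0 a1 \<phi>0 \<phi>1 r u \<longleftrightarrow>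
     u 0 = r \<and> (\<forall>t\<ge>0. positive_linf2 (u t) \<and>
       (u has_vector_derivative kinetic_field (u t)) (at t within {0..}))"
    (is "?lhs \<longleftrightarrow> ?rhs")
proof
  assume ?lhs
  then obtain D where "u 0 = r"
    and pos: "\<And>t. 0 \<le> t \<Longrightarrow> positive_linf2 (u t)"
    and u': "\<And>t. 0 \<le> t \<Longrightarrow> (u has_vector_derivative D t) (at t within {0..})"
    and D0: "\<And>t. 0 \<le> t \<Longrightarrow> AE x in lebesgue. rep_linf (comp0 (D t)) x =
      kinetic_rhs a0 \<phi>0 (rep_linf (comp0 (u t))) (rep_linf (comp1 (u t))) x"
    and D1: "\<And>t. 0 \<le> t \<Longrightarrow> AE x in lebesgue. rep_linf (comp1 (D t)) x =
      kinetic_rhs a1 \<phi>1 (rep_linf (comp1 (u t))) (rep_linf (comp0 (u t))) x"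
    unfolding positive_global_solution_def global_solution_def by blast
  have "D t = kinetic_field (u t)" if "0 \<le> t" for t
  proof (rule linf2.expand, rule conjI)
    show "comp0 (D t) = comp0 (kinetic_field (u t))"
      unfolding linf_eq_iff kinetic_field_def linf2.sel
      using D0[OF that] rep_kinetic_linf[OF a0 \<phi>0, of "comp0 (u t)" "comp1 (u t)"]
      by eventually_elim simp
    show "comp1 (D t) = comp1 (kinetic_field (u t))"
      unfolding linf_eq_iff kinetic_field_def linf2.sel
      using D1[OF that] rep_kinetic_linf[OF a1 \<phi>1, of "comp1 (u t)" "comp0 (u t)"]
      by eventually_elim simp
  qed
  with \<open>u 0 = r\<close> pos u' show ?rhs by simp
next
  assume r: ?rhs
  then have "continuous_on {0..} u"
    unfolding continuous_on_eq_continuous_within by (auto intro: has_vector_derivative_continuous)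
  then have "continuous_on {0..} (\<lambda>t. kinetic_field (u t))"
    by (rule continuous_on_compose2[OF continuous_on_kinetic_field]) (use r in auto)
  with r show ?lhs
    unfolding positive_global_solution_def global_solution_def
    using rep_kinetic_linf[OF a0 \<phi>0] rep_kinetic_linf[OF a1 \<phi>1]
    by (auto intro!: exI[of _ "\<lambda>t. kinetic_field (u t)"] simp: kinetic_field_def)
qed

lemma positive_global_solution_unique:
  assumes u: "positive_global_solution a0 a1 \<phi>0 \<phi>1 r u"
    and v: "positive_global_solution a0 a1 \<phi>0 \<phi>1 r v" and t: "0 \<le> t"
  shows "v t = u t"
proof -
  have bdd: "bounded (w ` {0..t})" if "positive_global_solution a0 a1 \<phi>0 \<phi>1 r w" for w
  proof (intro compact_imp_bounded compact_continuous_image)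
    show "continuous_on {0..t} w"
      unfolding continuous_on_eq_continuous_within
    proof
      fix s assume "s \<in> {0..t}"
      then have "(w has_vector_derivative kinetic_field (w s)) (at s within {0..})"
        using that by (simp add: positive_global_solution_iff)
      then show "continuous (at s within {0..t}) w"
        by (intro has_vector_derivative_continuous[OF has_vector_derivative_within_subset]) auto
    qed
  qed auto
  from bdd[OF u] bdd[OF v] have "bounded (u ` {0..t} \<union> v ` {0..t})"
    by simp
  then obtain R where R: "\<And>s. 0 \<le> s \<Longrightarrow> s \<le> t \<Longrightarrow> norm (u s) \<le> R \<and> norm (v s) \<le> R"
    unfolding bounded_iff by (force simp: ball_Un)
  obtain L where L: "0 \<le> L"
    and lip: "\<And>u v. positive_linf2 u \<Longrightarrow> positive_linf2 v \<Longrightarrow> norm u \<le> R \<Longrightarrow> norm v \<le> R \<Longrightarrow>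
      norm (kinetic_field u - kinetic_field v) \<le> L * norm (u - v)"
    using kinetic_field_lipschitz[of R] by blast
  have "v t - u t = 0"
  proof (rule gronwall_zero[OF t _ _ L])
    show "v 0 - u 0 = 0"
      using u v by (simp add: positive_global_solution_iff)
    fix s assume s: "0 \<le> s" "s \<le> t"
    show "((\<lambda>t. v t - u t) has_vector_derivative kinetic_field (v s) - kinetic_field (u s)) (at s within {0..})"
      using u v s by (intro has_vector_derivative_diff) (simp_all add: positive_global_solution_iff)
    show "norm (kinetic_field (v s) - kinetic_field (u s)) \<le> L * norm (v s - u s)"
      using u v s R by (intro lip) (simp_all add: positive_global_solution_iff)
  qed
  then show ?thesis by simp
qed

text \<open>
  The tube theorem is applied to \<open>v t = exp (l t) u t\<close>, where \<open>l\<close> dominates both loss rates. One common \<open>l\<close>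
  serves both components: its value cancels in the final bounds.
\<close>

theorem positive_global_solution_exists:
  assumes r: "positive_linf2 r"
  obtains u where "positive_global_solution a0 a1 \<phi>0 \<phi>1 r u"
    and "\<And>t. 0 \<le> t \<Longrightarrow> AE x in lebesgue.
      rep_linf (comp0 (u t)) x \<le> norm (comp0 r) * exp ((\<integral>x. a0 x \<partial>lebesgue) * t)"
    and "\<And>t. 0 \<le> t \<Longrightarrow> AE x in lebesgue.
      rep_linf (comp1 (u t)) x \<le> norm (comp1 r) * exp ((\<integral>x. a1 x \<partial>lebesgue) * t)"
proof -
  define \<alpha>0 \<alpha>1 where "\<alpha>0 = (\<integral>x. a0 x \<partial>lebesgue)" and "\<alpha>1 = (\<integral>x. a1 x \<partial>lebesgue)"
  define l where "l = \<alpha>0 + \<alpha>1"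
  have \<alpha>: "0 \<le> \<alpha>0" "0 \<le> \<alpha>1" and l: "0 \<le> l" "\<alpha>0 \<le> l" "\<alpha>1 \<le> l"
    using a0 a1 by (simp_all add: \<alpha>0_def \<alpha>1_def l_def)
  define m0 m1 where "m0 t = norm (comp0 r) * exp ((l + \<alpha>0) * t)"
    and "m1 t = norm (comp1 r) * exp ((l + \<alpha>1) * t)" for t
  have m_nonneg: "0 \<le> m0 t" "0 \<le> m1 t" for t
    by (simp_all add: m0_def m1_def)
  have m_mono: "m0 s \<le> m0 t" "m1 s \<le> m1 t" if "s \<le> t" for s t
    using that \<alpha> l by (auto simp: m0_def m1_def intro!: mult_left_mono)
  \<comment> \<open>The tube: componentwise order intervals whose upper endpoints solve \<open>m' = (l + \<alpha>) m\<close>.\<close>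
  define K where "K t = {v :: 'a linf2. (AE x in lebesgue. 0 \<le> rep_linf (comp0 v) x \<and> rep_linf (comp0 v) x \<le> m0 t) \<and>
      (AE x in lebesgue. 0 \<le> rep_linf (comp1 v) x \<and> rep_linf (comp1 v) x \<le> m1 t)}" for t
  define H where "H t v = exp (l * t) *\<^sub>R kinetic_field (exp (- l * t) *\<^sub>R v) + l *\<^sub>R v" for t and v :: "'a linf2"
  have K_pos: "positive_linf2 (exp (- l * t) *\<^sub>R v)" if "v \<in> K t" for t v
  proof -
    have "nonneg_linf (comp0 v)" "nonneg_linf (comp1 v)"
      using that by (auto simp: K_def nonneg_linf_def)
    then show ?thesis
      by (simp add: positive_linf2_iff scaleR_linf2_def nonneg_linf_scaleR)
  qed
  have K_norm: "norm v \<le> m0 t + m1 t" if "v \<in> K t" for t v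
  proof -
    have "norm (comp0 v) \<le> m0 t" "norm (comp1 v) \<le> m1 t"
      using that unfolding K_def norm_linf_le_iff by auto
    with m_nonneg[of t] show ?thesis
      unfolding norm_linf2_le_iff by linarith
  qed
  have K_scaled: "AE x in lebesgue. 0 \<le> rep_linf (exp (- l * t) *\<^sub>R comp0 v) x \<and>
        rep_linf (exp (- l * t) *\<^sub>R comp0 v) x \<le> exp (- l * t) * m0 t"
      "AE x in lebesgue. 0 \<le> rep_linf (exp (- l * t) *\<^sub>R comp1 v) x \<and>
        rep_linf (exp (- l * t) *\<^sub>R comp1 v) x \<le> exp (- l * t) * m1 t"
    if "v \<in> K t" for t v
  proof -
    have v: "AE x in lebesgue. 0 \<le> rep_linf (comp0 v) x \<and> rep_linf (comp0 v) x \<le> m0 t"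
      "AE x in lebesgue. 0 \<le> rep_linf (comp1 v) x \<and> rep_linf (comp1 v) x \<le> m1 t"
      using that unfolding K_def by blast+
    show "AE x in lebesgue. 0 \<le> rep_linf (exp (- l * t) *\<^sub>R comp0 v) x \<and>
        rep_linf (exp (- l * t) *\<^sub>R comp0 v) x \<le> exp (- l * t) * m0 t"
      by (rule AE_interval_scaleR[OF v(1) exp_ge_zero])
    show "AE x in lebesgue. 0 \<le> rep_linf (exp (- l * t) *\<^sub>R comp1 v) x \<and>
        rep_linf (exp (- l * t) *\<^sub>R comp1 v) x \<le> exp (- l * t) * m1 t"
      by (rule AE_interval_scaleR[OF v(2) exp_ge_zero])
  qed
  have r_mem: "r \<in> K t" if "0 \<le> t" for t
  proof -
    have "norm (comp0 r) \<le> m0 t" "norm (comp1 r) \<le> m1 t"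
      using m_mono[OF that] by (simp_all add: m0_def m1_def)
    moreover have "AE x in lebesgue. 0 \<le> rep_linf f x \<and> rep_linf f x \<le> m"
      if "nonneg_linf f" "norm f \<le> m" for f :: "'a linf" and m
      using nonneg_linf_interval[OF that(1)] by eventually_elim (use that(2) in simp)
    ultimately show ?thesis
      using r by (simp add: K_def positive_linf2_iff del: AE_conj_iff)
  qed
  have comp_H: "comp0 (H t v) = exp (l * t) *\<^sub>R
        (kinetic_linf a0 \<phi>0 (exp (- l * t) *\<^sub>R comp0 v) (exp (- l * t) *\<^sub>R comp1 v)
         + l *\<^sub>R (exp (- l * t) *\<^sub>R comp0 v))"
    "comp1 (H t v) = exp (l * t) *\<^sub>R
        (kinetic_linf a1 \<phi>1 (exp (- l * t) *\<^sub>R comp1 v) (exp (- l * t) *\<^sub>R comp0 v)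
         + l *\<^sub>R (exp (- l * t) *\<^sub>R comp1 v))" for t v
    by (simp_all add: H_def kinetic_field_def plus_linf2_def scaleR_linf2_def scaleR_add_right exp_minus)
  \<comment> \<open>In the rescaled variables a function between \<open>0\<close> and \<open>m\<close> produces a derivative between \<open>0\<close> and
    \<open>(l + \<alpha>) m\<close>, the derivative of the upper endpoint of the tube.\<close>
  have field_bounds: "AE x in lebesgue.
      0 \<le> rep_linf (exp (l * t) *\<^sub>R (kinetic_linf a \<phi> f g + l *\<^sub>R f)) x \<and>
      rep_linf (exp (l * t) *\<^sub>R (kinetic_linf a \<phi> f g + l *\<^sub>R f)) x \<le> (l + (\<integral>x. a x \<partial>lebesgue)) * m"
    if "\<And>x. 0 \<le> a x" "integrable lebesgue a" "\<And>x. 0 \<le> \<phi> x" "integrable lebesgue \<phi>"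
      "(\<integral>x. a x \<partial>lebesgue) \<le> l" "nonneg_linf g"
      "AE x in lebesgue. 0 \<le> rep_linf f x \<and> rep_linf f x \<le> exp (- l * t) * m"
    for a \<phi> f g m t
  proof -
    have "exp (l * t) * ((l + (\<integral>x. a x \<partial>lebesgue)) * (exp (- l * t) * m)) = (l + (\<integral>x. a x \<partial>lebesgue)) * m"
      by (simp add: exp_minus)
    with AE_interval_scaleR[OF kinetic_linf_bounds[OF that(1-4,7,6,5)], of "exp (l * t)"]
    show ?thesis by (simp only: exp_ge_zero)
  qed
  obtain v where v0: "v 0 = r" and vK: "\<And>t. 0 \<le> t \<Longrightarrow> v t \<in> K t"
    and v': "\<And>t. 0 \<le> t \<Longrightarrow> (v has_vector_derivative H t (v t)) (at t within {0..})"
  proof (rule picard_lindelof_tube[of K r H])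
    show "closed (K t)" for t
      unfolding K_def AE_interval_iff_norm
      by (intro closed_Collect_conj closed_Collect_le continuous_intros
          bounded_linear.continuous_on[OF bounded_linear_comp0]
          bounded_linear.continuous_on[OF bounded_linear_comp1])
    show "r \<in> K t" if "0 \<le> t" for t
      by (rule r_mem[OF that])
    show "continuous_on {0..} (\<lambda>t. H t (u t))"
      if u: "continuous_on {0..} u" "\<And>t. 0 \<le> t \<Longrightarrow> u t \<in> K t" for u
      unfolding H_def
      by (intro continuous_intros u(1) continuous_on_compose2[OF continuous_on_kinetic_field])
        (use u(2) K_pos in auto)
    show "\<exists>L\<ge>0. \<forall>t\<in>{0..T}. \<forall>x\<in>K t. \<forall>y\<in>K t. norm (H t x - H t y) \<le> L * norm (x - y)"
      if "0 \<le> T" for T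
    proof -
      let ?R = "m0 T + m1 T"
      obtain L where L: "0 \<le> L"
        and lip: "\<And>u v. positive_linf2 u \<Longrightarrow> positive_linf2 v \<Longrightarrow> norm u \<le> ?R \<Longrightarrow> norm v \<le> ?R \<Longrightarrow>
          norm (kinetic_field u - kinetic_field v) \<le> L * norm (u - v)"
        using kinetic_field_lipschitz[of ?R] by blast
      show ?thesis
      proof (intro exI[of _ "L + l"] conjI ballI)
        show "0 \<le> L + l" using L l by simp
        fix t x y assume t: "t \<in> {0..T}" and xy: "x \<in> K t" "y \<in> K t"
        let ?e = "exp (- l * t)"
        have R: "norm (?e *\<^sub>R z) \<le> ?R" if "z \<in> K t" for z
        proof -
          have "norm (?e *\<^sub>R z) \<le> 1 * norm z"
            unfolding norm_scaleR by (rule mult_right_mono) (use t l in auto)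
          with K_norm[OF that] m_mono[of t T] t show ?thesis by auto
        qed
        have "norm (kinetic_field (?e *\<^sub>R x) - kinetic_field (?e *\<^sub>R y))
            \<le> L * norm (?e *\<^sub>R x - ?e *\<^sub>R y)"
          by (intro lip K_pos R xy)
        also have "\<dots> = ?e * (L * norm (x - y))"
          by (simp add: scaleR_diff_right[symmetric] del: scaleR_diff_right)
        finally have field_le: "norm (kinetic_field (?e *\<^sub>R x) - kinetic_field (?e *\<^sub>R y))
            \<le> ?e * (L * norm (x - y))" .
        have "H t x - H t y =
            exp (l * t) *\<^sub>R (kinetic_field (?e *\<^sub>R x) - kinetic_field (?e *\<^sub>R y)) + l *\<^sub>R (x - y)"
          by (simp add: H_def algebra_simps)
        also have "norm \<dots> \<le> exp (l * t) * (?e * (L * norm (x - y))) + l * norm (x - y)"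
          using field_le l by (intro order_trans[OF norm_triangle_ineq]) (simp add: mult_left_mono)
        also have "\<dots> = (L + l) * norm (x - y)"
          by (simp add: exp_minus distrib_right)
        finally show "norm (H t x - H t y) \<le> (L + l) * norm (x - y)" .
      qed
    qed
    show "w t \<in> K t" if u: "\<And>t. 0 \<le> t \<Longrightarrow> u t \<in> K t" and w0: "w 0 = r"
        and w': "\<And>t. 0 \<le> t \<Longrightarrow> (w has_vector_derivative H t (u t)) (at t within {0..})"
        and t: "0 \<le> t" for u w t
    proof -
      have f: "nonneg_linf (exp (- l * s) *\<^sub>R comp0 (u s))" "nonneg_linf (exp (- l * s) *\<^sub>R comp1 (u s))"
        if "0 \<le> s" for s
        using K_pos[OF u[OF that]] by (simp_all add: positive_linf2_iff scaleR_linf2_def)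
      have m': "(m0 has_real_derivative (l + \<alpha>0) * m0 s) (at s)"
          "(m1 has_real_derivative (l + \<alpha>1) * m1 s) (at s)" for s
        unfolding m0_def m1_def by (auto intro!: derivative_eq_intros)
      show ?thesis
        unfolding K_def
      proof (intro CollectI conjI)
        show "AE x in lebesgue. 0 \<le> rep_linf (comp0 (w t)) x \<and> rep_linf (comp0 (w t)) x \<le> m0 t"
        proof (rule AE_interval_of_derivative[OF t _ m'(1)])
          show "((\<lambda>t. comp0 (w t)) has_vector_derivative comp0 (H s (u s))) (at s within {0..})"
            if "0 \<le> s" for s
            by (rule bounded_linear.has_vector_derivative[OF bounded_linear_comp0 w'[OF that]])
          show "AE x in lebesgue. 0 \<le> rep_linf (comp0 (H s (u s))) x \<and>
              rep_linf (comp0 (H s (u s))) x \<le> (l + \<alpha>0) * m0 s" if "0 \<le> s" for s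
            unfolding comp_H \<alpha>0_def
            by (rule field_bounds[OF a0 \<phi>0 _ f(2)[OF that] K_scaled(1)[OF u[OF that]]])
              (use l in \<open>simp add: \<alpha>0_def\<close>)
          show "AE x in lebesgue. 0 \<le> rep_linf (comp0 (w 0)) x \<and> rep_linf (comp0 (w 0)) x \<le> m0 0"
            using r_mem[of 0] by (simp add: w0 K_def)
        qed
        show "AE x in lebesgue. 0 \<le> rep_linf (comp1 (w t)) x \<and> rep_linf (comp1 (w t)) x \<le> m1 t"
        proof (rule AE_interval_of_derivative[OF t _ m'(2)])
          show "((\<lambda>t. comp1 (w t)) has_vector_derivative comp1 (H s (u s))) (at s within {0..})"
            if "0 \<le> s" for s
            by (rule bounded_linear.has_vector_derivative[OF bounded_linear_comp1 w'[OF that]])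
          show "AE x in lebesgue. 0 \<le> rep_linf (comp1 (H s (u s))) x \<and>
              rep_linf (comp1 (H s (u s))) x \<le> (l + \<alpha>1) * m1 s" if "0 \<le> s" for s
            unfolding comp_H \<alpha>1_def
            by (rule field_bounds[OF a1 \<phi>1 _ f(1)[OF that] K_scaled(2)[OF u[OF that]]])
              (use l in \<open>simp add: \<alpha>1_def\<close>)
          show "AE x in lebesgue. 0 \<le> rep_linf (comp1 (w 0)) x \<and> rep_linf (comp1 (w 0)) x \<le> m1 0"
            using r_mem[of 0] by (simp add: w0 K_def)
        qed
      qed
    qed
  qed blast
  define u where "u t = exp (- l * t) *\<^sub>R v t" for t
  have bounds: "AE x in lebesgue. 0 \<le> rep_linf (comp0 (u t)) x \<and>
        rep_linf (comp0 (u t)) x \<le> exp (- l * t) * m0 t"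
      "AE x in lebesgue. 0 \<le> rep_linf (comp1 (u t)) x \<and>
        rep_linf (comp1 (u t)) x \<le> exp (- l * t) * m1 t" if "0 \<le> t" for t
    using K_scaled[OF vK[OF that]] by (simp_all only: u_def scaleR_linf2_def linf2.sel)
  show thesis
  proof (rule that)
    show "positive_global_solution a0 a1 \<phi>0 \<phi>1 r u"
      unfolding positive_global_solution_iff
    proof (intro conjI allI impI)
      show "u 0 = r" by (simp add: u_def v0)
      fix t :: real assume t: "0 \<le> t"
      show "positive_linf2 (u t)"
        unfolding u_def by (rule K_pos[OF vK[OF t]])
      have "((\<lambda>t. exp (- l * t)) has_real_derivative - l * exp (- l * t)) (at t within {0..})"
        by (auto intro!: derivative_eq_intros)
      from has_vector_derivative_scaleR[OF this v'[OF t]]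
      show "(u has_vector_derivative kinetic_field (u t)) (at t within {0..})"
        by (simp add: u_def[abs_def] H_def scaleR_add_right exp_minus algebra_simps)
    qed
    show "AE x in lebesgue. rep_linf (comp0 (u t)) x \<le>
        norm (comp0 r) * exp ((\<integral>x. a0 x \<partial>lebesgue) * t)" if "0 \<le> t" for t
      using bounds(1)[OF that]
      by eventually_elim (simp add: m0_def \<alpha>0_def distrib_right exp_add exp_minus field_simps)
    show "AE x in lebesgue. rep_linf (comp1 (u t)) x \<le>
        norm (comp1 r) * exp ((\<integral>x. a1 x \<partial>lebesgue) * t)" if "0 \<le> t" for t
      using bounds(2)[OF that]
      by eventually_elim (simp add: m1_def \<alpha>1_def distrib_right exp_add exp_minus field_simps)
  qed
qed

end

theorem theorem3p8:
  fixes a\<^sub>0 a\<^sub>1 \<phi>\<^sub>0 \<phi>\<^sub>1 :: "'a::euclidean_space \<Rightarrow> real"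
    and \<alpha>\<^sub>0 \<alpha>\<^sub>1 :: real
    and \<rho>\<^sub>0 :: "'a linf2"
  assumes "\<And>x. 0 \<le> a\<^sub>0 x" "\<And>x. a\<^sub>0 x = a\<^sub>0 (- x)" "integrable lebesgue a\<^sub>0"
    and "\<And>x. 0 \<le> a\<^sub>1 x" "\<And>x. a\<^sub>1 x = a\<^sub>1 (- x)" "integrable lebesgue a\<^sub>1"
    and "\<alpha>\<^sub>0 = (\<integral>x. a\<^sub>0 x \<partial>lebesgue)" "\<alpha>\<^sub>1 = (\<integral>x. a\<^sub>1 x \<partial>lebesgue)"
    and "\<And>x. 0 \<le> \<phi>\<^sub>0 x" "\<And>x. \<phi>\<^sub>0 x = \<phi>\<^sub>0 (- x)" "integrable lebesgue \<phi>\<^sub>0"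
    and "esssup lebesgue (\<lambda>x. ereal (\<phi>\<^sub>0 x)) < \<infinity>"
    and "\<And>x. 0 \<le> \<phi>\<^sub>1 x" "\<And>x. \<phi>\<^sub>1 x = \<phi>\<^sub>1 (- x)" "integrable lebesgue \<phi>\<^sub>1"
    and "esssup lebesgue (\<lambda>x. ereal (\<phi>\<^sub>1 x)) < \<infinity>"
    and "positive_linf2 \<rho>\<^sub>0"
  shows "\<exists>u. positive_global_solution a\<^sub>0 a\<^sub>1 \<phi>\<^sub>0 \<phi>\<^sub>1 \<rho>\<^sub>0 u \<and>
      (\<forall>t\<ge>0. AE x in lebesgue.
         rep_linf (comp0 (u t)) x \<le> norm (comp0 \<rho>\<^sub>0) * exp (\<alpha>\<^sub>0 * t) \<and>
         rep_linf (comp1 (u t)) x \<le> norm (comp1 \<rho>\<^sub>0) * exp (\<alpha>\<^sub>1 * t)) \<and>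
      (\<forall>v. positive_global_solution a\<^sub>0 a\<^sub>1 \<phi>\<^sub>0 \<phi>\<^sub>1 \<rho>\<^sub>0 v \<longrightarrow> (\<forall>t\<ge>0. v t = u t))"
proof -
  interpret kinetic_system a\<^sub>0 a\<^sub>1 \<phi>\<^sub>0 \<phi>\<^sub>1
    using assms by unfold_locales
  obtain u where u: "positive_global_solution a\<^sub>0 a\<^sub>1 \<phi>\<^sub>0 \<phi>\<^sub>1 \<rho>\<^sub>0 u"
    and bounds: "\<And>t. 0 \<le> t \<Longrightarrow> AE x in lebesgue.
        rep_linf (comp0 (u t)) x \<le> norm (comp0 \<rho>\<^sub>0) * exp (\<alpha>\<^sub>0 * t)"
      "\<And>t. 0 \<le> t \<Longrightarrow> AE x in lebesgue.
        rep_linf (comp1 (u t)) x \<le> norm (comp1 \<rho>\<^sub>0) * exp (\<alpha>\<^sub>1 * t)"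
    using positive_global_solution_exists[OF \<open>positive_linf2 \<rho>\<^sub>0\<close>]
    unfolding \<open>\<alpha>\<^sub>0 = _\<close> \<open>\<alpha>\<^sub>1 = _\<close> by blast
  show ?thesis
  proof (intro exI[of _ u] conjI allI impI)
    show "positive_global_solution a\<^sub>0 a\<^sub>1 \<phi>\<^sub>0 \<phi>\<^sub>1 \<rho>\<^sub>0 u" by (rule u)
    show "AE x in lebesgue.
        rep_linf (comp0 (u t)) x \<le> norm (comp0 \<rho>\<^sub>0) * exp (\<alpha>\<^sub>0 * t) \<and>
        rep_linf (comp1 (u t)) x \<le> norm (comp1 \<rho>\<^sub>0) * exp (\<alpha>\<^sub>1 * t)" if "0 \<le> t" for t
      using bounds[OF that] by (rule eventually_conj)
    show "v t = u t" if "positive_global_solution a\<^sub>0 a\<^sub>1 \<phi>\<^sub>0 \<phi>\<^sub>1 \<rho>\<^sub>0 v" "0 \<le> t" for v t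
      by (rule positive_global_solution_unique[OF u that])
  qed
qed

end
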